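(* Let $k$ be a positive integer and let $\Lambda,\Delta,\Gamma$ be three proper families of partitions satisfying $\max(|\Lambda|,|\Delta|)\le|\Gamma|\le|\Lambda|+|\Delta|$. For any integer $n\ge|\Gamma|$ we have $$c_{\underline{\Lambda}_n\,\underline{\Delta}_n}^{\underline{\Gamma}_n}=\sum_{r=0}^{n-|\Gamma|}c_{\Lambda\Delta}^{\underline{\Gamma}_{|\Gamma|+r}}\binom{n-|\Gamma|}{r},$$ where the left-hand side is a structure coefficient of the center $Z(\mathbb{C}[\mathcal{B}_{kn}^k])$, and the numbers $c_{\Lambda\Delta}^{\underline{\Gamma}_{|\Gamma|+r}}$ are structure coefficients of the algebra $\mathcal{I}_\infty^k$, which are non-negative integers independent of $n$.
   Context: Fix a positive integer $k$. For $i\ge1$ let $p_k(i)=\{(i-1)k+1,\dots,ik\}$; such a set is called a $k$-tuple. $\mathcal{B}_{kn}^k$ is the group of permutations $\omega$ of $[kn]=\{1,\dots,kn\}$ sending every $p_k(r)$, $1\le r\le n$, onto some $p_k(r')$, $1\le r'\le n$ (it is isomorphic to $\mathcal{S}_k\wr\mathcal{S}_n$). More generally, for a finite disjoint union $d$ of $k$-tuples, $\mathcal{B}_d^k$ is the group of permutations of $d$ that permute the $k$-tuples contained in $d$. A family of partitions is $\Lambda=(\Lambda(\lambda))_{\lambda\vdash k}$, where each $\Lambda(\lambda)$ is a (possibly empty) partition; $|\Lambda|=\sum_{\lambda\vdash k}|\Lambda(\lambda)|$. It is proper if $\Lambda(1^k)$ has no part equal to $1$, where $(1^k)$ is the partition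 of $k$ with all parts $1$. For $n\ge|\Lambda|$, $\underline{\Lambda}_n$ is obtained from $\Lambda$ by adding $n-|\Lambda|$ parts equal to $1$ to $\Lambda(1^k)$, so $|\underline{\Lambda}_n|=n$. Type: for $\omega\in\mathcal{B}_d^k$, consider each cycle, of length $m$ say, of the permutation induced by $\omega$ on the $k$-tuples of $d$. The union of the $k$-tuples in this cycle is a union of cycles of $\omega$; choose one of these $k$-tuples $p_k(i)$ and let $\rho\vdash k$ be the partition formed by the numbers of elements of $p_k(i)$ lying in each of these cycles of $\omega$ (independent of the choice of $i$). This contributes one part $m$ to a partition denoted $\omega(\rho)$. The type of $\omega$ is the family $(\omega(\rho))_{\rho\vdash k}$ of partitions so obtained. The conjugacy classes of $\mathcal{B}_{kn}^k$ are the sets $C_\Lambda$ of elements of type $\Lambda$, for families $\Lambda$ with $|\Lambda|=n$; $\mathbf{C}_\Lambda$ denotes the sum of the elements of $C_\Lambda$ in $\mathbb{C}[\mathcal{B}_{kn}^k]$. For $|\Lambda|=|\Delta|=n$, the structure coefficients of $Z(\mathbb{C}[\mathcal{B}_{kn}^k])$ are defined by $\mathbf{C}_\Lambda\mathbf{C}_\Delta=\sum_{|\Gamma|=n}c_{\Lambda\Delta}^\Gamma\mathbf{C}_\Gamma$ in $Z(\mathbb{C}[\mathcal{B}_{kn}^k])$. A $k$-partial permutation is a pair $(d,\omega)$ with $d$ a finite disjoint union of $k$-tuples and $\omega\in\mathcal{B}_d^k$; its type is the type of $\omega$. The product is $(d_1,\omega_1)(d_2,\omega_2)=(d_1\cup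 d_2,\omega_1\omega_2)$, with $\omega_1,\omega_2$ extended by the identity to $d_1\cup d_2$. $\mathcal{I}_\infty^k$ is the algebra of finite complex linear combinations of the formal (infinite) sums $\mathbf{C}_\Lambda=\sum(d,\omega)$ over all $k$-partial permutations $(d,\omega)$ of type $\Lambda$ (so $d$ consists of $|\Lambda|$ $k$-tuples), for all families $\Lambda$ of partitions. Its structure coefficients are defined by $\mathbf{C}_\Lambda\mathbf{C}_\Delta=\sum_\Gamma c_{\Lambda\Delta}^\Gamma\mathbf{C}_\Gamma$ in $\mathcal{I}_\infty^k$. The same letter $c$ is used for both kinds of coefficients, as in the claim. *)

theory Defs
  imports Complex_Main "HOL-Library.Multiset" "HOL-Combinatorics.Permutations"
    "HOL-Combinatorics.Orbits" "HOL-Algebra.Module"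
begin

section \<open>Families of partitions\<close>

text \<open>A partition is the multiset of its (positive) parts.  A family \<open>\<Lambda>\<close> indexed by the
  partitions of \<open>k\<close> is a function on all multisets that is empty off the partitions of \<open>k\<close>;
  this makes equality of families the same as equality of functions.\<close>

type_synonym partition = "nat multiset"
type_synonym family = "partition \<Rightarrow> partition"

definition is_partition :: "partition \<Rightarrow> bool" where
  "is_partition p \<longleftrightarrow> 0 \<notin># p"

definition partitions_of :: "nat \<Rightarrow> partition set" where
  "partitions_of k = {p. is_partition p \<and> sum_mset p = k}"

definition families :: "nat \<Rightarrow> family set" where
  "families k = {\<Lambda>. (\<forall>p \<in> partitions_of k. is_partition (\<Lambda> p)) \<and>
                     (\<forall>p. p \<notin> partitions_of k \<longrightarrow> \<Lambda> p = {#})}"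

definition fam_size :: "nat \<Rightarrow> family \<Rightarrow> nat" where
  "fam_size k \<Lambda> = (\<Sum>p \<in> partitions_of k. sum_mset (\<Lambda> p))"

definition ones :: "nat \<Rightarrow> partition" where
  "ones k = replicate_mset k 1"

definition proper :: "nat \<Rightarrow> family \<Rightarrow> bool" where
  "proper k \<Lambda> \<longleftrightarrow> 1 \<notin># \<Lambda> (ones k)"

text \<open>The completion of \<open>\<Lambda>\<close> to size \<open>n\<close>; meaningful for \<open>fam_size k \<Lambda> \<le> n\<close>.\<close>

definition complete_to :: "nat \<Rightarrow> nat \<Rightarrow> family \<Rightarrow> family" where
  "complete_to k n \<Lambda> = \<Lambda>(ones k := \<Lambda> (ones k) + replicate_mset (n - fam_size k \<Lambda>) 1)"


section \<open>\<open>k\<close>-tuples, the groups \<open>B\<^sub>d\<close> and types\<close>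

definition tuple :: "nat \<Rightarrow> nat \<Rightarrow> nat set" where
  "tuple k i = {(i - 1) * k + 1 .. i * k}"

definition tuple_union :: "nat \<Rightarrow> nat set \<Rightarrow> bool" where
  "tuple_union k d \<longleftrightarrow> (\<exists>I. finite I \<and> I \<subseteq> {1..} \<and> d = (\<Union>i\<in>I. tuple k i))"

definition tuples_in :: "nat \<Rightarrow> nat set \<Rightarrow> nat set set" where
  "tuples_in k d = {p. (\<exists>i\<ge>1. p = tuple k i) \<and> p \<subseteq> d}"

text \<open>Permutations of \<open>d\<close> are functions on \<open>nat\<close> that are the identity off \<open>d\<close>, so
  the extension of a permutation by the identity to a larger set is the same function.\<close>

definition B_perms :: "nat \<Rightarrow> nat set \<Rightarrow> (nat \<Rightarrow> nat) set" where
  "B_perms k d = {\<omega>. \<omega> permutes d \<and> (\<forall>p \<in> tuples_in k d. \<omega> ` p \<in> tuples_in k d)}"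

definition B_group :: "nat \<Rightarrow> nat set \<Rightarrow> (nat \<Rightarrow> nat) monoid" where
  "B_group k d = \<lparr>carrier = B_perms k d, mult = (\<circ>), one = id\<rparr>"

text \<open>The cycles of the permutation \<open>p \<mapsto> \<omega> ` p\<close> of the \<open>k\<close>-tuples in \<open>d\<close>, each cycle given as
  the set of the tuples in it.\<close>

definition tuple_cycles :: "nat \<Rightarrow> nat set \<Rightarrow> (nat \<Rightarrow> nat) \<Rightarrow> nat set set set" where
  "tuple_cycles k d \<omega> = {orbit ((`) \<omega>) p | p. p \<in> tuples_in k d}"

text \<open>The partition attached to a cycle \<open>c\<close> of tuples: the cycles of \<open>\<omega>\<close> on \<open>\<Union>c\<close> cut a chosen
  tuple of \<open>c\<close> into pieces.\<close>

definition cycle_partition :: "(nat \<Rightarrow> nat) \<Rightarrow> nat set set \<Rightarrow> partition" where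
  "cycle_partition \<omega> c = (let p = (SOME p. p \<in> c) in
     image_mset (\<lambda>z. card (p \<inter> z)) (mset_set {orbit \<omega> x | x. x \<in> \<Union>c}))"

definition perm_type :: "nat \<Rightarrow> nat set \<Rightarrow> (nat \<Rightarrow> nat) \<Rightarrow> family" where
  "perm_type k d \<omega> =
     (\<lambda>\<rho>. image_mset card (mset_set {c \<in> tuple_cycles k d \<omega>. cycle_partition \<omega> c = \<rho>}))"

definition partial_perms :: "nat \<Rightarrow> (nat set \<times> (nat \<Rightarrow> nat)) monoid" where
  "partial_perms k =
     \<lparr>carrier = {(d, \<omega>). tuple_union k d \<and> \<omega> \<in> B_perms k d},
      mult = (\<lambda>(d1, \<omega>1) (d2, \<omega>2). (d1 \<union> d2, \<omega>1 \<circ> \<omega>2)),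
      one = ({}, id)\<rparr>"


section \<open>Algebras of formal sums and structure coefficients\<close>

text \<open>A possibly infinite formal sum of elements of a monoid is its coefficient function.
  The convolution product makes sense on all formal sums when every element has only finitely
  many factorizations; \<open>finite_factorizations\<close> below shows this for partial permutations.\<close>

definition convolution ::
  "('x, 'm) monoid_scheme \<Rightarrow> ('x \<Rightarrow> complex) \<Rightarrow> ('x \<Rightarrow> complex) \<Rightarrow> 'x \<Rightarrow> complex" where
  "convolution M f g =
     (\<lambda>x. \<Sum>(a, b) | a \<in> carrier M \<and> b \<in> carrier M \<and> a \<otimes>\<^bsub>M\<^esub> b = x. f a * g b)"

definition sum_of :: "'x set \<Rightarrow> 'x \<Rightarrow> complex" where
  "sum_of C = (\<lambda>x. if x \<in> C then 1 else 0)"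

definition formal_algebra ::
  "('x, 'm) monoid_scheme \<Rightarrow> ('x \<Rightarrow> complex) set \<Rightarrow> (complex, 'x \<Rightarrow> complex) module" where
  "formal_algebra M S =
     \<lparr>carrier = S, mult = convolution M, one = sum_of {\<one>\<^bsub>M\<^esub>},
      zero = (\<lambda>_. 0), add = (\<lambda>f g x. f x + g x), smult = (\<lambda>a f x. a * f x)\<rparr>"

definition group_algebra ::
  "('x, 'm) monoid_scheme \<Rightarrow> (complex, 'x \<Rightarrow> complex) module" where
  "group_algebra G =
     formal_algebra G {f. finite {x. f x \<noteq> 0} \<and> {x. f x \<noteq> 0} \<subseteq> carrier G}"

definition center_of :: "('c, 'a, 'm) module_scheme \<Rightarrow> ('c, 'a, 'm) module_scheme" where
  "center_of A =
     A\<lparr>carrier := {z \<in> carrier A. \<forall>a \<in> carrier A. z \<otimes>\<^bsub>A\<^esub> a = a \<otimes>\<^bsub>A\<^esub> z}\<rparr>"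

text \<open>The coefficients of the product of two elements of the family \<open>(b i)\<^sub>i\<^sub>\<in>\<^sub>I\<close> of an algebra \<open>A\<close>,
  expanded in that family and extended by zero off \<open>I\<close>.\<close>

definition structure_coeff ::
  "(complex, 'a) module \<Rightarrow> 'i set \<Rightarrow> ('i \<Rightarrow> 'a) \<Rightarrow> 'i \<Rightarrow> 'i \<Rightarrow> 'i \<Rightarrow> complex" where
  "structure_coeff A I b i j =
     (THE c. finite {l. c l \<noteq> 0} \<and> {l. c l \<noteq> 0} \<subseteq> I \<and>
             b i \<otimes>\<^bsub>A\<^esub> b j = (\<Oplus>\<^bsub>A\<^esub>l \<in> {l. c l \<noteq> 0}. c l \<odot>\<^bsub>A\<^esub> b l))"


section \<open>The center of the group algebra of \<open>B\<^sub>k\<^sub>n\<close>\<close>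

definition conj_class :: "nat \<Rightarrow> nat \<Rightarrow> family \<Rightarrow> (nat \<Rightarrow> nat) set" where
  "conj_class k n \<Lambda> = {\<omega> \<in> B_perms k {1..k*n}. perm_type k {1..k*n} \<omega> = \<Lambda>}"

definition center_algebra :: "nat \<Rightarrow> nat \<Rightarrow> (complex, (nat \<Rightarrow> nat) \<Rightarrow> complex) module" where
  "center_algebra k n = center_of (group_algebra (B_group k {1..k*n}))"

definition center_coeff :: "nat \<Rightarrow> nat \<Rightarrow> family \<Rightarrow> family \<Rightarrow> family \<Rightarrow> complex" where
  "center_coeff k n = structure_coeff (center_algebra k n)
     {\<Lambda> \<in> families k. fam_size k \<Lambda> = n} (\<lambda>\<Lambda>. sum_of (conj_class k n \<Lambda>))"


section \<open>The algebra of \<open>k\<close>-partial permutations\<close>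

definition partial_class :: "nat \<Rightarrow> family \<Rightarrow> (nat set \<times> (nat \<Rightarrow> nat)) set" where
  "partial_class k \<Lambda> = {(d, \<omega>) \<in> carrier (partial_perms k). perm_type k d \<omega> = \<Lambda>}"

definition partial_algebra ::
  "nat \<Rightarrow> (complex, nat set \<times> (nat \<Rightarrow> nat) \<Rightarrow> complex) module" where
  "partial_algebra k = formal_algebra (partial_perms k)
     {\<lambda>x. \<Sum>\<Lambda>\<in>F. a \<Lambda> * sum_of (partial_class k \<Lambda>) x | F a. finite F \<and> F \<subseteq> families k}"

definition partial_coeff :: "nat \<Rightarrow> family \<Rightarrow> family \<Rightarrow> family \<Rightarrow> complex" where
  "partial_coeff k = structure_coeff (partial_algebra k)
     (families k) (\<lambda>\<Lambda>. sum_of (partial_class k \<Lambda>))"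


section \<open>Finiteness of the sums used above\<close>

lemma finite_partitions_of: "finite (partitions_of k)"
proof (rule finite_subset)
  show "partitions_of k \<subseteq> mset ` {xs. set xs \<subseteq> {..k} \<and> length xs \<le> k}"
  proof
    fix p assume p: "p \<in> partitions_of k"
    obtain xs where xs: "p = mset xs" using ex_mset by metis
    have s: "sum_list xs = k" and z: "0 \<notin> set xs"
      using p by (auto simp: partitions_of_def is_partition_def xs sum_mset_sum_list)
    have "length xs \<le> sum_list xs" using z by (induction xs) auto
    moreover have "set xs \<subseteq> {..k}" using s member_le_sum_list by auto
    ultimately show "p \<in> mset ` {xs. set xs \<subseteq> {..k} \<and> length xs \<le> k}"
      using xs s by auto
  qed
  show "finite (mset ` {xs. set xs \<subseteq> {..k} \<and> length xs \<le> k})"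
    by (intro finite_imageI finite_lists_length_le) auto
qed

lemma finite_factorizations:
  "finite {(x, y). x \<in> carrier (partial_perms k) \<and> y \<in> carrier (partial_perms k) \<and>
                   x \<otimes>\<^bsub>partial_perms k\<^esub> y = z}"
proof -
  obtain d \<omega> where z: "z = (d, \<omega>)" by (cases z)
  show ?thesis
  proof (cases "finite d")
    case True
    let ?P = "SIGMA e : Pow d. {\<sigma>. \<sigma> permutes e}"
    have "finite ?P"
      using True by (intro finite_SigmaI) (auto intro!: finite_permutations dest: finite_subset)
    then have "finite (?P \<times> ?P)" by simp
    then show ?thesis
      by (rule finite_subset[rotated]) (auto simp: partial_perms_def B_perms_def z)
  next
    case False
    have "finite e" if "tuple_union k e" for e
      using that by (auto simp: tuple_union_def tuple_def)
    then have "{(x, y). x \<in> carrier (partial_perms k) \<and> y \<in> carrier (partial_perms k) \<and>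
                   x \<otimes>\<^bsub>partial_perms k\<^esub> y = z} = {}"
      using False by (auto simp: partial_perms_def z)
    then show ?thesis by (metis finite.emptyI)
  qed
qed

end

theory Submission
  imports Defs
begin

text \<open>An element \<open>\<omega>\<close> of \<open>B\<^sub>k\<^sub>n\<close> whose type is the completion of a proper family \<open>\<Lambda>\<close> has a canonical
  lift to a partial permutation of type \<open>\<Lambda>\<close>: its domain is the union of the tuples that \<open>\<omega>\<close> does not
  fix pointwise, and properness makes this the only possible domain.  Fix \<open>\<omega>\<close> whose type is the
  completion of \<open>\<Gamma>\<close>.  The factorizations of \<open>\<omega>\<close> counted by the left-hand side thus lift bijectively
  to factorizations of the partial permutations \<open>(d, \<omega>)\<close>, where \<open>d\<close> ranges over the unions of tuples
  between the support of \<open>\<omega>\<close> and \<open>{1..k n}\<close>.  There are \<open>(n - |\<Gamma>|) choose r\<close> such \<open>d\<close> with \<open>|\<Gamma>| + r\<close>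
  tuples, and each \<open>(d, \<omega>)\<close> has \<open>c\<close> factorizations, \<open>c\<close> being the coefficient at \<open>\<Gamma>\<close> completed to size
  \<open>|\<Gamma>| + r\<close>.

  That structure coefficients count factorizations rests on the fact that the type is a complete
  conjugacy invariant and that every family occurs as a type.  Both follow because a cycle of \<open>m\<close>
  tuples whose attached partition has parts \<open>r\<^sub>i\<close> is isomorphic to the successor map on the disjoint
  union of the cyclic groups of orders \<open>m r\<^sub>i\<close>, the tuples being the residue classes modulo \<open>m\<close>.\<close>

section \<open>Cycles of finite injections and block permutations\<close>

text \<open>The model of a cycle has pairs (part, position) as points, so it is not a set of
  k-tuples. The type is therefore studied for any finite system of disjoint blocks of size
  \<open>k\<close> and only then specialised; block isomorphisms connect models, group elements and
  partial permutations.

  Conjugation of partial permutations meets an obstacle: two of equal type may have different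
  domains, so an isomorphism between them is not yet a permutation. It is extended to the union of
  both domains by a bijection of the leftover tuples, which are equally many because the type
  determines the number of tuples.

  Both kinds of coefficients are given by a definite description over class sums. Reading them as
  numbers of factorizations needs nonempty disjoint classes, a count that is constant on each class,
  and finitely many types in a product. Realization of families gives the first, conjugation the
  second; for partial permutations the third holds because the domains of the two factors cover that
  of the product.\<close>

lemma orbit_self_finite:
  assumes "finite A" "inj_on f A" "f ` A \<subseteq> A" "x \<in> A"
  shows "x \<in> orbit f x" and "orbit f x \<subseteq> A"
proof -
  \<comment> \<open>Off \<open>A\<close> the function \<open>f\<close> is arbitrary. Replacing it
    there by the identity gives a permutation of the whole type with the same orbits inside
    \<open>A\<close>. This puts \<open>x\<close> into its own orbit, which is not automatic because
    \<open>orbit\<close> collects only iterates with positive exponent.\<close>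
  have "bij_betw f A A"
    using assms by (simp add: bij_betw_def endo_inj_surj)
  then have "bij_betw (perm_restrict f A) A A"
    by (rule bij_betw_cong[THEN iffD1, rotated]) (simp add: perm_restrict_simps)
  then have perm: "perm_restrict f A permutes A"
    by (rule bij_imp_permutes) (simp add: perm_restrict_simps)
  have eq: "orbit f x = orbit (perm_restrict f A) x"
    by (rule orbit_cong0[of x A]) (use assms in \<open>auto simp: perm_restrict_simps\<close>)
  have "permutation (perm_restrict f A)"
    using perm assms(1) by (auto simp: permutation_permutes)
  then show "x \<in> orbit f x"
    unfolding eq by (rule permutation_self_in_orbit)
  show "orbit f x \<subseteq> A"
    unfolding eq using perm assms(4) by (rule permutes_orbit_subset)
qed

lemma orbit_eq_if_mem: "y \<in> orbit f x \<Longrightarrow> x \<in> orbit f x \<Longrightarrow> orbit f y = orbit f x"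
  by (metis cyclic_on_singleI orbit_cyclic_eq3)

text \<open>The first return time of \<open>x\<close> is the size of its orbit. Expressed through
  \<open>card\<close>, it can be compared with the parts of a partition; the enumeration starts at
  \<open>x\<close> itself, with exponent 0.\<close>

lemma orbit_funpow_card:
  assumes "x \<in> orbit f x"
  shows "inj_on (\<lambda>n. (f ^^ n) x) {..<card (orbit f x)}"
    and "orbit f x = (\<lambda>n. (f ^^ n) x) ` {..<card (orbit f x)}"
    and "(f ^^ card (orbit f x)) x = x"
    and "card (orbit f x) > 0"
proof -
  have c: "card (orbit f x) = funpow_dist1 f x x"
    using arg_cong[OF orbit_conv_funpow_dist1[OF assms], of card] card_image[OF inj_on_funpow_dist1[OF assms]]
    by simp
  show "inj_on (\<lambda>n. (f ^^ n) x) {..<card (orbit f x)}"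
    using inj_on_funpow_dist1[OF assms] by (simp only: c lessThan_atLeast0)
  show "orbit f x = (\<lambda>n. (f ^^ n) x) ` {..<card (orbit f x)}"
    unfolding c lessThan_atLeast0 by (rule orbit_conv_funpow_dist1[OF assms])
  show "(f ^^ card (orbit f x)) x = x"
    using funpow_dist1_prop[OF assms] by (simp only: c)
  show "card (orbit f x) > 0"
    by (simp only: c)
qed

lemma funpow_image: "((`) (f :: 'a \<Rightarrow> 'a) ^^ n) p = (f ^^ n) ` p"
  by (induction n) (simp_all add: image_comp)

text \<open>This definition and the next two restate the type of a permutation with the tuples in
  \<open>d\<close> replaced by any set of blocks, over any type of points.\<close>

definition block_cycles :: "'a set set \<Rightarrow> ('a \<Rightarrow> 'a) \<Rightarrow> 'a set set set" where
  "block_cycles P \<omega> = orbit ((`) \<omega>) ` P"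

definition cut_partition :: "('a \<Rightarrow> 'a) \<Rightarrow> 'a set set \<Rightarrow> partition" where
  "cut_partition \<omega> c =
     image_mset (\<lambda>z. card ((SOME p. p \<in> c) \<inter> z)) (mset_set (orbit \<omega> ` \<Union>c))"

definition block_type :: "'a set set \<Rightarrow> ('a \<Rightarrow> 'a) \<Rightarrow> family" where
  "block_type P \<omega> =
     (\<lambda>\<rho>. image_mset card (mset_set {c \<in> block_cycles P \<omega>. cut_partition \<omega> c = \<rho>}))"

text \<open>Nothing is required off the blocks, so isomorphisms can be glued and can compare
  functions that behave differently elsewhere.\<close>

definition block_iso ::
  "'a set set \<Rightarrow> ('a \<Rightarrow> 'a) \<Rightarrow> 'b set set \<Rightarrow> ('b \<Rightarrow> 'b) \<Rightarrow> ('a \<Rightarrow> 'b) \<Rightarrow> bool" where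
  "block_iso P \<omega> Q \<omega>' f \<longleftrightarrow> bij_betw f (\<Union>P) (\<Union>Q) \<and> (`) f ` P = Q \<and>
     (\<forall>x \<in> \<Union>P. f (\<omega> x) = \<omega>' (f x))"

text \<open>Positivity of \<open>k\<close> makes every block finite as well as nonempty, since
  \<open>card\<close> of an infinite set is 0.\<close>

locale block_system =
  fixes k :: nat and P :: "'a set set"
  assumes k_pos: "0 < k"
    and fin: "finite P"
    and block_card: "p \<in> P \<Longrightarrow> card p = k"
    and block_unique: "p \<in> P \<Longrightarrow> q \<in> P \<Longrightarrow> x \<in> p \<Longrightarrow> x \<in> q \<Longrightarrow> p = q"
begin

lemma fin_block: "p \<in> P \<Longrightarrow> finite p"
  using block_card k_pos by (metis card_ge_0_finite)

lemma block_nonempty: "p \<in> P \<Longrightarrow> p \<noteq> {}"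
  using block_card k_pos by fastforce

lemma fin_Union: "finite (\<Union>P)"
  using fin fin_block by blast

lemma block_system_subset: "Q \<subseteq> P \<Longrightarrow> block_system k Q"
proof
  fix p q x assume "Q \<subseteq> P" "p \<in> Q" "q \<in> Q" "x \<in> p" "x \<in> q"
  then show "p = q" using block_unique by blast
qed (use k_pos fin block_card in \<open>auto intro: finite_subset\<close>)

lemma Union_disjoint: "Q \<subseteq> P \<Longrightarrow> R \<subseteq> P \<Longrightarrow> Q \<inter> R = {} \<Longrightarrow> \<Union>Q \<inter> \<Union>R = {}"
  using block_unique by blast

end

text \<open>Finiteness of \<open>P\<close> upgrades injectivity to a permutation of the points and
  of the blocks. As there is no condition off the blocks, an invariant subset of \<open>P\<close>
  can be treated with the same function.\<close>

locale block_perm = block_system k P for k and P :: "'a set set" +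
  fixes \<omega> :: "'a \<Rightarrow> 'a"
  assumes maps: "p \<in> P \<Longrightarrow> \<omega> ` p \<in> P"
    and inj: "inj_on \<omega> (\<Union>P)"
begin

lemma maps_elem: "x \<in> \<Union>P \<Longrightarrow> \<omega> x \<in> \<Union>P"
  using maps by blast

lemma inj_image: "inj_on ((`) \<omega>) P"
  by (rule inj_on_subset[OF inj_on_image_Pow[OF inj]]) auto

lemma self_orbit_block: "p \<in> P \<Longrightarrow> p \<in> orbit ((`) \<omega>) p"
  and orbit_block_subset: "p \<in> P \<Longrightarrow> orbit ((`) \<omega>) p \<subseteq> P"
  using orbit_self_finite[OF fin inj_image] maps by auto

lemma self_orbit: "x \<in> \<Union>P \<Longrightarrow> x \<in> orbit \<omega> x"
  and orbit_subset: "x \<in> \<Union>P \<Longrightarrow> orbit \<omega> x \<subseteq> \<Union>P"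
  using orbit_self_finite[OF fin_Union inj] maps_elem by blast+

lemma block_perm_subset:
  assumes "Q \<subseteq> P" "\<And>p. p \<in> Q \<Longrightarrow> \<omega> ` p \<in> Q"
  shows "block_perm k Q \<omega>"
proof -
  interpret Q: block_system k Q by (rule block_system_subset) fact
  show ?thesis
    by unfold_locales (use assms inj in \<open>auto intro: inj_on_subset\<close>)
qed

lemma finite_block_cycles: "finite (block_cycles P \<omega>)"
  unfolding block_cycles_def using fin by blast

lemma orbit_mem_block_cycles: "p \<in> P \<Longrightarrow> orbit ((`) \<omega>) p \<in> block_cycles P \<omega>"
  unfolding block_cycles_def by blast

lemma Union_block_cycles: "\<Union>(block_cycles P \<omega>) = P"
  unfolding block_cycles_def using self_orbit_block orbit_block_subset by blast

context
  fixes c assumes c: "c \<in> block_cycles P \<omega>"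
begin

lemma cycle_subset: "c \<subseteq> P"
  using c Union_block_cycles by blast

lemma cycle_finite: "finite c"
  using cycle_subset fin finite_subset by blast

lemma cycle_nonempty: "c \<noteq> {}"
  using c by (auto simp: block_cycles_def orbit_nonempty)

lemma card_cycle_pos: "0 < card c"
  using cycle_nonempty cycle_finite by (simp add: card_gt_0_iff)

lemma cycle_eq_orbit: "p \<in> c \<Longrightarrow> c = orbit ((`) \<omega>) p"
  using c self_orbit_block by (auto simp: block_cycles_def intro!: orbit_eq_if_mem[symmetric])

lemma cycle_maps: "p \<in> c \<Longrightarrow> \<omega> ` p \<in> c"
  using cycle_eq_orbit by (metis orbit.base)

lemma block_perm_cycle: "block_perm k c \<omega>"
  by (rule block_perm_subset[OF cycle_subset cycle_maps])

text \<open>A block mapped into \<open>c\<close> has the same orbit as its image, hence lies in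
  \<open>c\<close> already. This allows an induction to remove one cycle at a time.\<close>

lemma block_perm_minus_cycle: "block_perm k (P - c) \<omega>"
proof (rule block_perm_subset)
  fix p assume p: "p \<in> P - c"
  have "\<omega> ` p \<notin> c"
  proof
    assume "\<omega> ` p \<in> c"
    then have "c = orbit ((`) \<omega>) (\<omega> ` p)" by (rule cycle_eq_orbit)
    also have "\<dots> = orbit ((`) \<omega>) p" using p by (intro self_in_orbit_step self_orbit_block) simp
    finally show False using p self_orbit_block by auto
  qed
  then show "\<omega> ` p \<in> P - c" using maps p by blast
qed auto

text \<open>For a cycle z of \<omega>, the map \<omega> sends \<open>q \<inter> z\<close>
  bijectively onto its image block intersected with z, and iteration reaches every block of
  \<open>c\<close>. The arbitrary choice of a block in \<open>cut_partition\<close> is therefore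
  harmless.\<close>

lemma card_block_Int_orbit:
  assumes "p \<in> c" "q \<in> c" "x \<in> \<Union>P"
  shows "card (q \<inter> orbit \<omega> x) = card (p \<inter> orbit \<omega> x)"
proof -
  have step: "card (\<omega> ` q \<inter> orbit \<omega> x) = card (q \<inter> orbit \<omega> x)" if q: "q \<in> P" for q
  proof -
    have "\<omega> ` q \<inter> orbit \<omega> x = \<omega> ` (q \<inter> orbit \<omega> x)"
    proof (intro equalityI subsetI)
      fix z assume z: "z \<in> \<omega> ` q \<inter> orbit \<omega> x"
      then obtain y where y: "y \<in> q" "z = \<omega> y" by blast
      have "y \<in> orbit \<omega> y" using y q self_orbit by blast
      then have "orbit \<omega> y = orbit \<omega> z" using self_in_orbit_step y by metis
      also have "\<dots> = orbit \<omega> x" using z self_orbit[OF assms(3)] orbit_eq_if_mem by (metis IntD2)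
      finally show "z \<in> \<omega> ` (q \<inter> orbit \<omega> x)" using y \<open>y \<in> orbit \<omega> y\<close> by blast
    next
      fix z assume "z \<in> \<omega> ` (q \<inter> orbit \<omega> x)"
      then show "z \<in> \<omega> ` q \<inter> orbit \<omega> x" by (auto intro: orbit.step)
    qed
    moreover have "inj_on \<omega> (q \<inter> orbit \<omega> x)" using inj q by (auto intro: inj_on_subset)
    ultimately show ?thesis by (simp add: card_image)
  qed
  have "q \<in> orbit ((`) \<omega>) p" using assms cycle_eq_orbit by auto
  moreover have "p \<in> P" using assms cycle_subset by auto
  ultimately show ?thesis
  proof induction
    case base then show ?case using step by simp
  next
    case (step y) 
    then have "y \<in> P" using orbit_block_subset by blast
    then show ?case using step \<open>\<And>q. q \<in> P \<Longrightarrow> _\<close> by simp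
  qed
qed

lemma cut_partition_eq:
  assumes "p \<in> c"
  shows "cut_partition \<omega> c = image_mset (\<lambda>z. card (p \<inter> z)) (mset_set (orbit \<omega> ` \<Union>c))"
  unfolding cut_partition_def
proof (rule image_mset_cong)
  fix z assume "z \<in># mset_set (orbit \<omega> ` \<Union>c)"
  moreover have "finite (orbit \<omega> ` \<Union>c)"
    using fin_Union cycle_subset by (meson Union_mono finite_imageI finite_subset)
  ultimately obtain x where "x \<in> \<Union>P" "z = orbit \<omega> x" using cycle_subset by auto
  then show "card ((SOME p. p \<in> c) \<inter> z) = card (p \<inter> z)"
    using card_block_Int_orbit[OF assms, of "SOME p. p \<in> c" x] someI[of "\<lambda>p. p \<in> c", OF assms] by simp
qed

text \<open>A cycle of \<omega> meets all blocks of \<open>c\<close> in equally many points, so its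
  length is \<open>card c\<close> times the part it contributes. As this length is positive, the
  cycle meets every block and can be entered from the chosen \<open>p\<close>.\<close>

lemma cycle_orbits:
  assumes "p \<in> c" "z \<in> orbit \<omega> ` \<Union>c"
  shows "z \<subseteq> \<Union>c" and "card z = card c * card (p \<inter> z)" and "\<exists>y\<in>p. z = orbit \<omega> y"
proof -
  interpret c: block_perm k c \<omega> by (rule block_perm_cycle)
  obtain x where x: "x \<in> \<Union>c" "z = orbit \<omega> x" using assms by auto
  then show zc: "z \<subseteq> \<Union>c" using c.orbit_subset by auto
  have xP: "x \<in> \<Union>P" using x cycle_subset by auto
  have "z = (\<Union>q\<in>c. q \<inter> z)" using zc by auto
  then have "card z = card (\<Union>q\<in>c. q \<inter> z)" by simp
  also have "\<dots> = (\<Sum>q\<in>c. card (q \<inter> z))"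
  proof (rule card_UN_disjoint)
    show "\<forall>q\<in>c. \<forall>q'\<in>c. q \<noteq> q' \<longrightarrow> (q \<inter> z) \<inter> (q' \<inter> z) = {}"
      using c.block_unique by blast
  qed (simp_all add: cycle_finite c.fin_block)
  also have "\<dots> = (\<Sum>q\<in>c. card (p \<inter> z))"
    by (rule sum.cong) (simp_all add: x(2) card_block_Int_orbit[OF assms(1) _ xP])
  finally show "card z = card c * card (p \<inter> z)" by simp
  moreover have "card z > 0"
    using orbit_funpow_card(4) self_orbit[OF xP] x by simp
  ultimately have "p \<inter> z \<noteq> {}" by auto
  then obtain y where y: "y \<in> p" "y \<in> z" by auto
  then have "orbit \<omega> y = z" using x xP self_orbit orbit_eq_if_mem by metis
  then show "\<exists>y\<in>p. z = orbit \<omega> y" using y by auto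
qed

text \<open>The cycles of \<omega> cut \<open>p\<close> into disjoint pieces that cover it, and no
  piece is empty because every cycle meets \<open>p\<close>.\<close>

lemma cut_partition_mem: "cut_partition \<omega> c \<in> partitions_of k"
proof -
  interpret c: block_perm k c \<omega> by (rule block_perm_cycle)
  obtain p where p: "p \<in> c" using cycle_nonempty by auto
  let ?Z = "orbit \<omega> ` \<Union>c"
  have fin: "finite ?Z" using c.fin_Union by blast
  have "card (p \<inter> z) \<noteq> 0" if z: "z \<in> ?Z" for z
  proof -
    obtain x where x: "x \<in> p" "z = orbit \<omega> x" using cycle_orbits(3)[OF p, of z] z by blast
    then have "x \<in> p \<inter> z" using p c.self_orbit by blast
    then show ?thesis using p c.fin_block by auto
  qed
  moreover have "(\<Sum>z\<in>?Z. card (p \<inter> z)) = k"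
  proof -
    have "(\<Sum>z\<in>?Z. card (p \<inter> z)) = card (\<Union>z\<in>?Z. p \<inter> z)"
    proof (rule card_UN_disjoint[symmetric])
      show "\<forall>z\<in>?Z. \<forall>z'\<in>?Z. z \<noteq> z' \<longrightarrow> (p \<inter> z) \<inter> (p \<inter> z') = {}"
      proof (intro ballI impI equals0I)
        fix z z' y assume "z \<in> ?Z" "z' \<in> ?Z" "z \<noteq> z'" "y \<in> (p \<inter> z) \<inter> (p \<inter> z')"
        moreover from this have "orbit \<omega> y = z" "orbit \<omega> y = z'"
          by (auto intro!: orbit_eq_if_mem c.self_orbit)
        ultimately show False by simp
      qed
    qed (use fin p c.fin_block in auto)
    also have "(\<Union>z\<in>?Z. p \<inter> z) = p" using p c.self_orbit by auto
    finally show ?thesis using p c.block_card by simp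
  qed
  ultimately show ?thesis
    using fin unfolding cut_partition_eq[OF p] partitions_of_def is_partition_def
    by (fastforce simp add: sum_unfold_sum_mset)
qed

end

lemma block_cycles_disjoint:
  assumes "c \<in> block_cycles P \<omega>" "c' \<in> block_cycles P \<omega>" "p \<in> c" "p \<in> c'"
  shows "c = c'"
  using assms cycle_eq_orbit by metis

end

section \<open>The type as an isomorphism invariant\<close>

context block_perm
begin

lemma block_type_families: "block_type P \<omega> \<in> families k"
proof -
  have pos: "0 \<notin># block_type P \<omega> \<rho>" for \<rho>
    using finite_block_cycles card_cycle_pos by (force simp: block_type_def)
  have "block_type P \<omega> \<rho> = {#}" if "\<rho> \<notin> partitions_of k" for \<rho>
  proof -
    have "{c \<in> block_cycles P \<omega>. cut_partition \<omega> c = \<rho>} = {}"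
      using that cut_partition_mem by auto
    then show ?thesis by (simp only: block_type_def mset_set.empty image_mset_empty)
  qed
  with pos show ?thesis by (auto simp: families_def is_partition_def)
qed

text \<open>The cycles partition the blocks, and grouping them by cut partition loses none, each
  being a partition of \<open>k\<close>. In particular equal types force equally many
  blocks.\<close>

lemma fam_size_block_type: "fam_size k (block_type P \<omega>) = card P"
proof -
  have "fam_size k (block_type P \<omega>) =
      (\<Sum>\<rho>\<in>partitions_of k. \<Sum>c\<in>{c \<in> block_cycles P \<omega>. cut_partition \<omega> c = \<rho>}. card c)"
    unfolding fam_size_def block_type_def by (simp add: sum_unfold_sum_mset)
  also have "\<dots> = (\<Sum>c\<in>block_cycles P \<omega>. card c)"
    by (rule sum.group) (use finite_block_cycles finite_partitions_of cut_partition_mem in auto)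
  also have "\<dots> = card (\<Union>c\<in>block_cycles P \<omega>. c)"
  proof (rule card_UN_disjoint[symmetric])
    show "\<forall>c\<in>block_cycles P \<omega>. \<forall>c'\<in>block_cycles P \<omega>. c \<noteq> c' \<longrightarrow> c \<inter> c' = {}"
      using block_cycles_disjoint by blast
  qed (use finite_block_cycles cycle_finite in auto)
  also have "\<dots> = card P" using Union_block_cycles by simp
  finally show ?thesis .
qed

lemma block_type_Un:
  assumes "P = Q \<union> R" "Q \<inter> R = {}"
    and "\<And>p. p \<in> Q \<Longrightarrow> \<omega> ` p \<in> Q" "\<And>p. p \<in> R \<Longrightarrow> \<omega> ` p \<in> R"
  shows "block_type P \<omega> \<rho> = block_type Q \<omega> \<rho> + block_type R \<omega> \<rho>"
proof -
  interpret Q: block_perm k Q \<omega> by (rule block_perm_subset) (use assms in auto)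
  interpret R: block_perm k R \<omega> by (rule block_perm_subset) (use assms in auto)
  have "{c \<in> block_cycles P \<omega>. cut_partition \<omega> c = \<rho>} =
      {c \<in> block_cycles Q \<omega>. cut_partition \<omega> c = \<rho>} \<union> {c \<in> block_cycles R \<omega>. cut_partition \<omega> c = \<rho>}"
    unfolding assms(1) block_cycles_def by auto
  moreover have "block_cycles Q \<omega> \<inter> block_cycles R \<omega> = {}"
  proof (intro equals0I)
    fix c assume c: "c \<in> block_cycles Q \<omega> \<inter> block_cycles R \<omega>"
    then have "c \<subseteq> Q \<inter> R" using Q.cycle_subset R.cycle_subset by blast
    then show False using c Q.cycle_nonempty assms(2) by auto
  qed
  ultimately show ?thesis
    unfolding block_type_def
    using Q.finite_block_cycles R.finite_block_cycles
    by (subst image_mset_union[symmetric], subst mset_set_Union[symmetric]) auto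
qed

lemma block_type_cycle:
  assumes "c \<in> block_cycles P \<omega>"
  shows "block_type c \<omega> = (\<lambda>\<rho>. if \<rho> = cut_partition \<omega> c then {#card c#} else {#})"
proof -
  have "block_cycles c \<omega> = {c}"
    using cycle_eq_orbit[OF assms] cycle_nonempty[OF assms] by (auto simp: block_cycles_def)
  then have "{c' \<in> block_cycles c \<omega>. cut_partition \<omega> c' = \<rho>} =
      (if \<rho> = cut_partition \<omega> c then {c} else {})" for \<rho>
    by auto
  then show ?thesis by (auto simp: block_type_def fun_eq_iff)
qed

text \<open>Peeling off a cycle removes exactly one part from the type; this is the recursion behind
  the classification.\<close>

lemma block_type_split_cycle:
  assumes "c \<in> block_cycles P \<omega>"
  shows "block_type P \<omega> \<rho> =
    (if \<rho> = cut_partition \<omega> c then {#card c#} else {#}) + block_type (P - c) \<omega> \<rho>"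
proof -
  interpret R: block_perm k "P - c" \<omega> by (rule block_perm_minus_cycle[OF assms])
  have "block_type P \<omega> \<rho> = block_type c \<omega> \<rho> + block_type (P - c) \<omega> \<rho>"
    by (rule block_type_Un) (use cycle_subset[OF assms] cycle_maps[OF assms] R.maps in auto)
  then show ?thesis by (simp add: block_type_cycle[OF assms])
qed

end

text \<open>Orbits that start in the blocks never leave them, so the values of the functions
  elsewhere cannot influence the type.\<close>

lemma block_type_cong:
  assumes "block_perm k P \<omega>" "\<And>x. x \<in> \<Union>P \<Longrightarrow> \<omega> x = \<omega>' x"
  shows "block_type P \<omega>' = block_type P \<omega>"
proof -
  interpret block_perm k P \<omega> by fact
  have orb: "orbit \<omega>' x = orbit \<omega> x" if "x \<in> \<Union>P" for x
    by (rule orbit_cong0[symmetric, of x "\<Union>P"]) (use that maps_elem assms(2) in auto)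
  have img: "\<omega>' ` p = \<omega> ` p" if "p \<in> P" for p
    using assms(2)[OF UnionI[OF that]] by (intro image_cong) auto
  have "orbit ((`) \<omega>') p = orbit ((`) \<omega>) p" if "p \<in> P" for p
    by (rule orbit_cong0[symmetric, of p P]) (use that img maps in auto)
  then have cyc: "block_cycles P \<omega>' = block_cycles P \<omega>"
    by (auto simp: block_cycles_def)
  have "cut_partition \<omega>' c = cut_partition \<omega> c" if "c \<in> block_cycles P \<omega>" for c
  proof -
    have "orbit \<omega>' ` \<Union>c = orbit \<omega> ` \<Union>c"
      using cycle_subset[OF that] orb by (intro image_cong) auto
    then show ?thesis by (simp add: cut_partition_def)
  qed
  then have "{c \<in> block_cycles P \<omega>'. cut_partition \<omega>' c = \<rho>} =
      {c \<in> block_cycles P \<omega>. cut_partition \<omega> c = \<rho>}" for \<rho>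
    using cyc by auto
  then show ?thesis by (simp add: block_type_def)
qed

section \<open>Isomorphisms of block permutations\<close>

lemma block_iso_comp:
  assumes "block_iso P \<omega> Q \<omega>' f" "block_iso Q \<omega>' R \<omega>'' g"
  shows "block_iso P \<omega> R \<omega>'' (g \<circ> f)"
  using assms unfolding block_iso_def
  by (auto intro: bij_betw_trans simp: image_comp[symmetric] bij_betw_apply)

lemma block_iso_inv:
  assumes iso: "block_iso P \<omega> Q \<omega>' f" and maps: "\<And>p. p \<in> P \<Longrightarrow> \<omega> ` p \<in> P"
  shows "block_iso Q \<omega>' P \<omega> (inv_into (\<Union>P) f)"
proof -
  have bij: "bij_betw f (\<Union>P) (\<Union>Q)" and img: "(`) f ` P = Q"
    and eq: "\<And>x. x \<in> \<Union>P \<Longrightarrow> f (\<omega> x) = \<omega>' (f x)"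
    using iso unfolding block_iso_def by auto
  let ?g = "inv_into (\<Union>P) f"
  have gf: "?g (f x) = x" if "x \<in> \<Union>P" for x
    using bij that by (meson bij_betw_inv_into_left)
  have "?g ` f ` p = p" if "p \<in> P" for p
    using gf that by (force simp: image_comp)
  then have "(`) ?g ` Q = P"
    unfolding img[symmetric] by (simp add: image_comp)
  moreover have "?g (\<omega>' y) = \<omega> (?g y)" if "y \<in> \<Union>Q" for y
  proof -
    have "y \<in> f ` \<Union>P" using that unfolding bij_betw_imp_surj_on[OF bij] .
    then obtain x where x: "x \<in> \<Union>P" "y = f x" by (elim imageE)
    then have "\<omega> x \<in> \<Union>P" using maps by blast
    then show ?thesis using x eq[OF x(1)] gf by metis
  qed
  ultimately show ?thesis
    using bij_betw_inv_into[OF bij] by (simp add: block_iso_def)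
qed

text \<open>Since \<omega> preserves both halves, \<open>x\<close> and \<open>\<omega> x\<close>
  always fall under the same case of the glued map.\<close>

lemma block_iso_glue:
  assumes f: "block_iso P \<omega> Q \<omega>' f" and g: "block_iso P' \<omega> Q' \<omega>' g"
    and disj: "\<Union>P \<inter> \<Union>P' = {}" "\<Union>Q \<inter> \<Union>Q' = {}"
    and maps: "\<And>p. p \<in> P \<Longrightarrow> \<omega> ` p \<in> P" "\<And>p. p \<in> P' \<Longrightarrow> \<omega> ` p \<in> P'"
  shows "block_iso (P \<union> P') \<omega> (Q \<union> Q') \<omega>' (\<lambda>x. if x \<in> \<Union>P then f x else g x)"
proof -
  let ?h = "\<lambda>x. if x \<in> \<Union>P then f x else g x"
  have hf: "?h x = f x" if "x \<in> \<Union>P" for x using that by simp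
  have hg: "?h x = g x" if "x \<in> \<Union>P'" for x using that disj(1) by auto
  have feq: "f (\<omega> x) = \<omega>' (f x)" if "x \<in> \<Union>P" for x
    using f that unfolding block_iso_def by auto
  have geq: "g (\<omega> x) = \<omega>' (g x)" if "x \<in> \<Union>P'" for x
    using g that unfolding block_iso_def by auto
  have "bij_betw ?h (\<Union>P) (\<Union>Q)" "bij_betw ?h (\<Union>P') (\<Union>Q')"
    using f g unfolding block_iso_def
    by (auto simp del: Union_iff cong: bij_betw_cong simp: hf hg)
  then have "bij_betw ?h (\<Union>P \<union> \<Union>P') (\<Union>Q \<union> \<Union>Q')"
    using disj(2) by (rule bij_betw_combine)
  moreover have "(`) ?h ` (P \<union> P') = Q \<union> Q'"
  proof -
    have "?h ` p = f ` p" if "p \<in> P" for p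
      using that by (intro image_cong) auto
    moreover have "?h ` p = g ` p" if "p \<in> P'" for p
      using that hg by (intro image_cong) blast+
    ultimately have "(`) ?h ` P = (`) f ` P" "(`) ?h ` P' = (`) g ` P'"
      by (auto intro!: image_cong)
    then show ?thesis using f g by (simp add: image_Un block_iso_def)
  qed
  moreover have "?h (\<omega> x) = \<omega>' (?h x)" if "x \<in> \<Union>(P \<union> P')" for x
  proof (cases "x \<in> \<Union>P")
    case True
    then have "\<omega> x \<in> \<Union>P" using maps by blast
    then show ?thesis using feq[OF True] hf[OF True] hf[of "\<omega> x"] by argo
  next
    case False
    then have x: "x \<in> \<Union>P'" using that by auto
    then have "\<omega> x \<in> \<Union>P'" using maps by blast
    then show ?thesis using geq[OF x] hg[OF x] hg[of "\<omega> x"] by argo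
  qed
  ultimately show ?thesis
    unfolding block_iso_def Union_Un_distrib by blast
qed

text \<open>An isomorphism carries cycles of points to cycles of points and cycles of blocks to
  cycles of blocks, and it preserves the sizes of all intersections involved.\<close>

lemma block_type_iso:
  assumes "block_perm k P \<omega>" "block_perm k Q \<omega>'" "block_iso P \<omega> Q \<omega>' f"
  shows "block_type Q \<omega>' = block_type P \<omega>"
proof -
  interpret P: block_perm k P \<omega> by fact
  interpret Q: block_perm k Q \<omega>' by fact
  have bij: "bij_betw f (\<Union>P) (\<Union>Q)" and img: "(`) f ` P = Q"
    and eq: "\<And>x. x \<in> \<Union>P \<Longrightarrow> f (\<omega> x) = \<omega>' (f x)"
    using assms(3) unfolding block_iso_def by auto
  have inj: "inj_on f (\<Union>P)" using bij bij_betw_def by blast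
  \<comment> \<open>Points, blocks and cycles of blocks live on successive levels of sets, and
    \<open>mset_set\<close> commutes with images only under injectivity; hence \<open>f\<close> has
    to be lifted as an injection level by level.\<close>
  have inj1: "inj_on ((`) f) (Pow (\<Union>P))" using inj by (rule inj_on_image_Pow)
  have injP: "inj_on ((`) f) P" by (rule inj_on_subset[OF inj1]) auto
  have inj2: "inj_on ((`) ((`) f)) (Pow P)" using injP by (rule inj_on_image_Pow)
  let ?F = "(`) ((`) f)"
  have orb: "orbit \<omega>' (f x) = f ` orbit \<omega> x" if "x \<in> \<Union>P" for x
    by (rule orbit_inverse[OF P.self_orbit[OF that], symmetric])
       (rule eq[symmetric], rule subsetD[OF P.orbit_subset[OF that]])
  have imgeq: "\<omega>' ` f ` p = f ` \<omega> ` p" if "p \<in> P" for p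
    unfolding image_comp by (rule image_cong[OF refl]) (simp add: eq[OF UnionI[OF that]])
  have orb2: "orbit ((`) \<omega>') (f ` p) = ?F (orbit ((`) \<omega>) p)" if "p \<in> P" for p
    by (rule orbit_inverse[OF P.self_orbit_block[OF that], symmetric])
       (rule imgeq, rule subsetD[OF P.orbit_block_subset[OF that]])
  have cyc: "block_cycles Q \<omega>' = ?F ` block_cycles P \<omega>"
    unfolding block_cycles_def img[symmetric] image_image by (rule image_cong[OF refl], rule orb2)
  have cut: "cut_partition \<omega>' (?F c) = cut_partition \<omega> c" if c: "c \<in> block_cycles P \<omega>" for c
  proof -
    obtain p where p: "p \<in> c" using P.cycle_nonempty[OF c] by auto
    have cP: "c \<subseteq> P" using P.cycle_subset[OF c] .
    have Fc: "?F c \<in> block_cycles Q \<omega>'" using c cyc by blast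
    have U: "\<Union>(?F c) = f ` \<Union>c" by auto
    have sub: "orbit \<omega> ` \<Union>c \<subseteq> Pow (\<Union>P)" using cP P.orbit_subset by blast
    have "orbit \<omega>' ` \<Union>(?F c) = (`) f ` orbit \<omega> ` \<Union>c"
      unfolding U image_image
      by (rule image_cong[OF refl], rule orb) (use cP in auto)
    then have "mset_set (orbit \<omega>' ` \<Union>(?F c)) = image_mset ((`) f) (mset_set (orbit \<omega> ` \<Union>c))"
      using inj_on_subset[OF inj1 sub] by (simp add: image_mset_mset_set)
    then have "cut_partition \<omega>' (?F c) =
        image_mset (\<lambda>z. card (f ` p \<inter> f ` z)) (mset_set (orbit \<omega> ` \<Union>c))"
      using Q.cut_partition_eq[OF Fc, of "f ` p"] p by (simp add: multiset.map_comp o_def)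
    also have "\<dots> = image_mset (\<lambda>z. card (p \<inter> z)) (mset_set (orbit \<omega> ` \<Union>c))"
    proof (rule image_mset_cong)
      fix z assume "z \<in># mset_set (orbit \<omega> ` \<Union>c)"
      then have "z \<in> orbit \<omega> ` \<Union>c" by (metis elem_mset_set empty_iff mset_set.infinite set_mset_empty)
      then have z: "z \<subseteq> \<Union>P" using sub by auto
      have p': "p \<subseteq> \<Union>P" using p cP by auto
      have "f ` p \<inter> f ` z = f ` (p \<inter> z)" using inj_on_image_Int[OF inj p' z] by simp
      moreover have "inj_on f (p \<inter> z)" using p' inj by (auto intro: inj_on_subset)
      ultimately show "card (f ` p \<inter> f ` z) = card (p \<inter> z)" by (simp add: card_image)
    qed
    also have "\<dots> = cut_partition \<omega> c" using P.cut_partition_eq[OF c p] by simp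
    finally show ?thesis .
  qed
  have cards: "card (?F c) = card c" if "c \<in> block_cycles P \<omega>" for c
    using card_image inj_on_subset[OF injP P.cycle_subset[OF that]] by blast
  show ?thesis
  proof
    fix \<rho>
    let ?S = "{c \<in> block_cycles P \<omega>. cut_partition \<omega> c = \<rho>}"
    have "{c \<in> block_cycles Q \<omega>'. cut_partition \<omega>' c = \<rho>} = ?F ` ?S"
      unfolding cyc using cut by auto
    moreover have "inj_on ?F ?S"
      by (rule inj_on_subset[OF inj2]) (use P.cycle_subset in auto)
    ultimately have "block_type Q \<omega>' \<rho> = image_mset (\<lambda>c. card (?F c)) (mset_set ?S)"
      by (simp add: block_type_def image_mset_mset_set[symmetric] multiset.map_comp o_def)
    also have "\<dots> = block_type P \<omega> \<rho>"
      unfolding block_type_def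
      by (rule image_mset_cong) (use cards P.finite_block_cycles in auto)
    finally show "block_type Q \<omega>' \<rho> = block_type P \<omega> \<rho>" .
  qed
qed

lemma block_perm_id:
  assumes "block_system k P"
  shows "block_perm k P id"
proof -
  interpret block_system k P by fact
  show ?thesis by unfold_locales auto
qed

text \<open>Every block is a cycle of its own and is cut into singletons. Apart from describing
  added fixed tuples, this is a source of bijections: identities on equally many blocks have equal
  types, so the classification supplies a block-preserving bijection between them.\<close>

lemma block_type_id:
  assumes "block_system k P"
  shows "block_type P id = (\<lambda>\<rho>. if \<rho> = ones k then replicate_mset (card P) 1 else {#})"
proof -
  interpret block_perm k P id using assms by (rule block_perm_id)
  have orb: "orbit id x = {x}" for x :: 'b
    by (simp add: orbit_eq_singleton_iff)
  have cyc: "block_cycles P id = (\<lambda>p. {p}) ` P"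
    by (auto simp: block_cycles_def orb image_id[abs_def])
  have cut: "cut_partition id {p} = ones k" if "p \<in> P" for p
  proof -
    have "orbit id ` \<Union>{p} = (\<lambda>x. {x}) ` p" by (simp add: orb)
    then have "cut_partition id {p} = image_mset (\<lambda>z. card (p \<inter> z)) (mset_set ((\<lambda>x. {x}) ` p))"
      by (simp add: cut_partition_def)
    also have "\<dots> = image_mset (\<lambda>x. card (p \<inter> {x})) (mset_set p)"
      by (subst image_mset_mset_set[symmetric]) (auto simp: multiset.map_comp o_def)
    also have "\<dots> = image_mset (\<lambda>x. 1) (mset_set p)"
      by (rule image_mset_cong) (use that fin_block in auto)
    also have "\<dots> = ones k"
      using block_card that by (simp add: ones_def image_mset_const_eq)
    finally show ?thesis .
  qed
  show ?thesis
  proof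
    fix \<rho>
    have "{c \<in> block_cycles P id. cut_partition id c = \<rho>} =
        (if \<rho> = ones k then (\<lambda>p. {p}) ` P else {})"
      using cyc cut by auto
    moreover have "image_mset card (mset_set ((\<lambda>p. {p}) ` P)) = replicate_mset (card P) 1"
      by (subst image_mset_mset_set[symmetric]) (auto simp: multiset.map_comp o_def image_mset_const_eq)
    ultimately show "block_type P id \<rho> = (if \<rho> = ones k then replicate_mset (card P) 1 else {#})"
      by (simp add: block_type_def)
  qed
qed

section \<open>Classification of block permutations by their type\<close>

definition model_block :: "nat \<Rightarrow> nat list \<Rightarrow> nat \<Rightarrow> (nat \<times> nat) set" where
  "model_block m rs j = {(i, t). i < length rs \<and> t < m * rs ! i \<and> t mod m = j}"

definition model_blocks :: "nat \<Rightarrow> nat list \<Rightarrow> (nat \<times> nat) set set" where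
  "model_blocks m rs = model_block m rs ` {..<m}"

definition model_succ :: "nat \<Rightarrow> nat list \<Rightarrow> nat \<times> nat \<Rightarrow> nat \<times> nat" where
  "model_succ m rs = (\<lambda>(i, t). (i, Suc t mod (m * rs ! i)))"

lemma Union_model_blocks:
  "0 < m \<Longrightarrow> \<Union>(model_blocks m rs) = (SIGMA i:{..<length rs}. {..<m * rs ! i})"
  by (auto simp: model_blocks_def model_block_def)

text \<open>Each cycle of \<omega> gets a starting point in one common block \<open>p\<close>, and
  the pair \<open>(i, t)\<close> goes to the t-th iterate of the i-th starting point. As all starts
  lie in \<open>p\<close>, the residue of \<open>t\<close> modulo the number of blocks tells which
  block is reached.\<close>

lemma (in block_perm) cycle_iso_model:
  assumes c: "c \<in> block_cycles P \<omega>" and rs: "mset rs = cut_partition \<omega> c"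
  shows "\<exists>f. block_iso (model_blocks (card c) rs) (model_succ (card c) rs) c \<omega> f"
proof -
  interpret c: block_perm k c \<omega> by (rule block_perm_cycle[OF c])
  define m where "m = card c"
  have m: "0 < m" using card_cycle_pos[OF c] by (simp add: m_def)
  obtain p where p: "p \<in> c" using cycle_nonempty[OF c] by auto
  let ?Z = "orbit \<omega> ` \<Union>c"
  let ?g = "\<lambda>z. card (p \<inter> z)"
  have finZ: "finite ?Z" using c.fin_Union by simp
  obtain zs0 where zs0: "mset zs0 = mset_set ?Z" by (metis ex_mset)
  have "mset rs = mset (map ?g zs0)"
    unfolding rs cut_partition_eq[OF c p] by (simp add: zs0)
  \<comment> \<open>The order of \<open>rs\<close> is prescribed. Rearranging the list of cycles by
    this permutation makes the i-th cycle cut the piece of size \<open>rs ! i\<close> from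
    \<open>p\<close>.\<close>
  then obtain \<pi> where \<pi>: "\<pi> permutes {..<length (map ?g zs0)}"
      "permute_list \<pi> (map ?g zs0) = rs"
    by (rule mset_eq_permutation)
  define zs where "zs = permute_list \<pi> zs0"
  have "mset zs = mset_set ?Z"
    using \<pi> zs0 by (simp add: zs_def)
  then have "set zs = ?Z" "length zs = card ?Z"
    using finZ by (metis finite_set_mset_mset_set set_mset_mset, metis size_mset size_mset_set)
  then have zs: "set zs = ?Z" "distinct zs"
    by (simp_all add: card_distinct)
  have rs_zs: "rs = map ?g zs"
    using \<pi> by (simp add: zs_def permute_list_map)
  have "\<forall>i<length rs. \<exists>y\<in>p. zs ! i = orbit \<omega> y"
    using cycle_orbits(3)[OF c p] zs(1) rs_zs by (metis length_map nth_mem)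
  then obtain y where y: "\<And>i. i < length rs \<Longrightarrow> y i \<in> p \<and> zs ! i = orbit \<omega> (y i)"
    by metis
  have card_orb: "card (orbit \<omega> (y i)) = m * rs ! i" if "i < length rs" for i
  proof -
    have "zs ! i \<in> ?Z" using that zs(1) rs_zs by (metis length_map nth_mem)
    then show ?thesis using cycle_orbits(2)[OF c p] y[OF that] that by (simp add: rs_zs m_def)
  qed
  have self: "y i \<in> orbit \<omega> (y i)" if "i < length rs" for i
    using y[OF that] p c.self_orbit by blast
  define f where "f = (\<lambda>(i, t). (\<omega> ^^ t) (y i))"
  have U: "\<Union>(model_blocks m rs) = (SIGMA i:{..<length rs}. {..<m * rs ! i})"
    by (rule Union_model_blocks[OF m])
  have orb_im: "(\<lambda>t. f (i, t)) ` {..<m * rs ! i} = zs ! i" if "i < length rs" for i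
    using orbit_funpow_card(2)[OF self[OF that]] card_orb[OF that] y[OF that] by (simp add: f_def)
  have bij: "bij_betw f (\<Union>(model_blocks m rs)) (\<Union>c)"
    unfolding bij_betw_def
  proof
    show "inj_on f (\<Union>(model_blocks m rs))"
    proof (rule inj_onI)
      fix a b assume ab: "a \<in> \<Union>(model_blocks m rs)" "b \<in> \<Union>(model_blocks m rs)" "f a = f b"
      obtain i t i' t' where [simp]: "a = (i, t)" "b = (i', t')" by (cases a, cases b)
      have it: "i < length rs" "t < m * rs ! i" "i' < length rs" "t' < m * rs ! i'"
        using ab unfolding U by auto
      have "f a \<in> zs ! i" "f b \<in> zs ! i'" using orb_im it by fastforce+
      then have "zs ! i = zs ! i'"
        using ab(3) y[OF it(1)] y[OF it(3)] self it orbit_eq_if_mem by metis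
      then have ii: "i = i'" using zs(2) it rs_zs by (simp add: nth_eq_iff_index_eq)
      moreover have "t = t'"
        by (rule inj_onD[OF orbit_funpow_card(1)[OF self[OF it(1)]]])
           (use ab(3) it ii card_orb[OF it(1)] in \<open>auto simp: f_def\<close>)
      ultimately show "a = b" by simp
    qed
    have "f ` \<Union>(model_blocks m rs) = (\<Union>i<length rs. (\<lambda>t. f (i, t)) ` {..<m * rs ! i})"
      unfolding U by auto
    also have "\<dots> = (\<Union>i<length rs. zs ! i)" using orb_im by auto
    also have "\<dots> = \<Union>(set zs)" unfolding rs_zs by (auto simp: set_conv_nth)
    also have "\<dots> = \<Union>c" unfolding zs(1) using c.self_orbit c.orbit_subset by blast
    finally show "f ` \<Union>(model_blocks m rs) = \<Union>c" .
  qed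
  have p_orb: "p \<in> orbit ((`) \<omega>) p" using c.self_orbit_block p by auto
  have cyc: "c = (\<lambda>j. (\<omega> ^^ j) ` p) ` {..<m}"
    and inj_j: "inj_on (\<lambda>j. (\<omega> ^^ j) ` p) {..<m}"
    and per: "(\<omega> ^^ m) ` p = p"
    using orbit_funpow_card(1,2,3)[OF p_orb] cycle_eq_orbit[OF c p, symmetric]
    by (simp_all add: m_def funpow_image)
  have mod: "(\<omega> ^^ t) ` p = (\<omega> ^^ (t mod m)) ` p" for t
    using funpow_mod_eq[of m "(`) \<omega>" p t] per by (simp add: funpow_image)
  have f_mem: "f (i, t) \<in> (\<omega> ^^ (t mod m)) ` p" if "i < length rs" for i t
    using y[OF that] unfolding mod[of t, symmetric] by (auto simp: f_def)
  have blk: "f ` model_block m rs j = (\<omega> ^^ j) ` p" if j: "j < m" for j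
  proof (intro equalityI subsetI)
    fix w assume "w \<in> f ` model_block m rs j"
    then show "w \<in> (\<omega> ^^ j) ` p" using f_mem by (auto simp: model_block_def)
  next
    fix w assume w: "w \<in> (\<omega> ^^ j) ` p"
    have jc: "(\<omega> ^^ j) ` p \<in> c" using j cyc by blast
    then have "w \<in> \<Union>c" using w by blast
    then have "w \<in> f ` \<Union>(model_blocks m rs)" using bij by (simp add: bij_betw_def)
    \<comment> \<open>The preimage \<open>(i, t)\<close> comes from surjectivity onto the points of
      \<open>c\<close>. It places \<open>w\<close> in the block with number \<open>t mod m\<close>;
      since \<open>w\<close> also lies in the block with number \<open>j\<close>, disjointness
      identifies the two.\<close>
    then obtain i t where it: "i < length rs" "t < m * rs ! i" "w = f (i, t)" unfolding U by auto
    have "(\<omega> ^^ (t mod m)) ` p \<in> c" using cyc m by auto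
    then have "(\<omega> ^^ (t mod m)) ` p = (\<omega> ^^ j) ` p"
      using jc w f_mem[OF it(1)] it(3) by (intro c.block_unique) auto
    then have "t mod m = j" using inj_onD[OF inj_j] m j by simp
    then show "w \<in> f ` model_block m rs j" using it by (auto simp: model_block_def)
  qed
  have "(`) f ` model_blocks m rs = c"
  proof -
    have "(`) f ` model_blocks m rs = (\<lambda>j. (\<omega> ^^ j) ` p) ` {..<m}"
      unfolding model_blocks_def image_image using blk by simp
    then show ?thesis using cyc by simp
  qed
  moreover have "f (model_succ m rs x) = \<omega> (f x)" if x: "x \<in> \<Union>(model_blocks m rs)" for x
  proof -
    obtain i t where it: "x = (i, t)" "i < length rs" using x unfolding U by auto
    \<comment> \<open>The successor wraps around exactly when the iterates of \<omega> return to the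
      starting point.\<close>
    have "(\<omega> ^^ (m * rs ! i)) (y i) = y i"
      using orbit_funpow_card(3)[OF self[OF it(2)]] card_orb[OF it(2)] by simp
    then show ?thesis
      using funpow_mod_eq[of "m * rs ! i" \<omega> "y i" "Suc t"] by (simp add: it f_def model_succ_def)
  qed
  ultimately show ?thesis
    using bij unfolding block_iso_def m_def by blast
qed

lemma bij_betw_residue:
  fixes m :: nat
  assumes "j < m"
  shows "bij_betw (\<lambda>s. s * m + j) {..<r} {t. t < m * r \<and> t mod m = j}"
proof (rule bij_betwI[of _ _ _ "\<lambda>t. t div m"])
  show "(\<lambda>s. s * m + j) \<in> {..<r} \<rightarrow> {t. t < m * r \<and> t mod m = j}"
  proof
    fix s assume "s \<in> {..<r}"
    then have "Suc s * m \<le> r * m" by (intro mult_le_mono1) simp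
    then show "s * m + j \<in> {t. t < m * r \<and> t mod m = j}"
      using assms by (simp add: mult.commute)
  qed
  show "(\<lambda>t. t div m) \<in> {t. t < m * r \<and> t mod m = j} \<rightarrow> {..<r}"
    by (auto simp: less_mult_imp_div_less mult.commute)
qed (use assms in auto)

lemma card_model_block:
  assumes "j < m"
  shows "card (model_block m rs j) = sum_list rs"
proof -
  have "model_block m rs j = (SIGMA i:{..<length rs}. {t. t < m * rs ! i \<and> t mod m = j})"
    by (auto simp: model_block_def)
  then have "card (model_block m rs j) = (\<Sum>i<length rs. card {t. t < m * rs ! i \<and> t mod m = j})"
    by simp
  also have "\<dots> = (\<Sum>i<length rs. rs ! i)"
    using bij_betw_same_card[OF bij_betw_residue[OF assms]] by simp
  finally show ?thesis by (simp add: sum_list_sum_nth atLeast0LessThan)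
qed

lemma finite_model_block: "finite (model_block m rs j)"
  by (rule finite_subset[of _ "SIGMA i:{..<length rs}. {..<m * rs ! i}"]) (auto simp: model_block_def)

lemma inj_on_model_succ: "inj_on (model_succ m rs) (SIGMA i:{..<length rs}. {..<m * rs ! i})"
  by (rule inj_onI) (auto simp: model_succ_def mod_Suc split: if_splits)

text \<open>Because m divides \<open>m * rs ! i\<close>, the wrap-around respects residues modulo m.
  Inclusion is then enough, as all residue classes have the same size and the successor is
  injective.\<close>

lemma model_succ_image:
  assumes "j < m"
  shows "model_succ m rs ` model_block m rs j = model_block m rs (Suc j mod m)"
proof (rule card_subset_eq[OF finite_model_block])
  show "model_succ m rs ` model_block m rs j \<subseteq> model_block m rs (Suc j mod m)"
  proof
    fix x assume "x \<in> model_succ m rs ` model_block m rs j"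
    then obtain i t where it: "i < length rs" "t < m * rs ! i" "t mod m = j"
        "x = (i, Suc t mod (m * rs ! i))"
      by (auto simp: model_block_def model_succ_def)
    have "Suc t mod (m * rs ! i) mod m = Suc t mod m" by (simp add: mod_mod_cancel)
    then have "Suc t mod (m * rs ! i) mod m = Suc j mod m"
      using it(3) by (metis mod_Suc_eq)
    moreover have "Suc t mod (m * rs ! i) < m * rs ! i"
      using it(2) by (intro mod_less_divisor) linarith
    ultimately show "x \<in> model_block m rs (Suc j mod m)"
      using it by (simp add: model_block_def)
  qed
  have "inj_on (model_succ m rs) (model_block m rs j)"
    by (rule inj_on_subset[OF inj_on_model_succ]) (auto simp: model_block_def)
  then show "card (model_succ m rs ` model_block m rs j) = card (model_block m rs (Suc j mod m))"
    using assms by (simp add: card_image card_model_block)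
qed

lemma model_succ_maps: "b \<in> model_blocks m rs \<Longrightarrow> model_succ m rs ` b \<in> model_blocks m rs"
  by (auto simp: model_blocks_def model_succ_image)

text \<open>Induction on the number of blocks: a cycle of the first system has a partner in the
  second with the same length and the same cut partition, both are isomorphic to one model, and the
  remainders still have equal types.\<close>

theorem block_iso_if_block_type_eq:
  assumes "block_perm k P \<omega>" "block_perm k Q \<omega>'" "block_type P \<omega> = block_type Q \<omega>'"
  shows "\<exists>f. block_iso P \<omega> Q \<omega>' f"
  using assms
proof (induction "card P" arbitrary: P Q rule: less_induct)
  case less
  interpret P: block_perm k P \<omega> by fact
  interpret Q: block_perm k Q \<omega>' by fact
  have cards: "card P = card Q"
    using P.fam_size_block_type Q.fam_size_block_type less.prems(3) by simp
  show ?case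
  proof (cases "P = {}")
    case True
    then have "Q = {}" using cards Q.fin by simp
    with True have "block_iso P \<omega> Q \<omega>' f" for f by (simp add: block_iso_def bij_betw_def)
    then show ?thesis by blast
  next
    case False
    then obtain p where p: "p \<in> P" by auto
    define c where "c = orbit ((`) \<omega>) p"
    have c: "c \<in> block_cycles P \<omega>" using p by (simp add: c_def P.orbit_mem_block_cycles)
    have "card c \<in># block_type Q \<omega>' (cut_partition \<omega> c)"
      unfolding less.prems(3)[symmetric] P.block_type_split_cycle[OF c] by simp
    then obtain c' where c': "c' \<in> block_cycles Q \<omega>'" "card c' = card c"
        "cut_partition \<omega>' c' = cut_partition \<omega> c"
      using Q.finite_block_cycles by (auto simp: block_type_def)
    interpret Pc: block_perm k "P - c" \<omega> by (rule P.block_perm_minus_cycle[OF c])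
    interpret Qc: block_perm k "Q - c'" \<omega>' by (rule Q.block_perm_minus_cycle[OF c'(1)])
    have "block_type (P - c) \<omega> \<rho> = block_type (Q - c') \<omega>' \<rho>" for \<rho>
      using fun_cong[OF less.prems(3), of \<rho>]
      unfolding P.block_type_split_cycle[OF c] Q.block_type_split_cycle[OF c'(1)] c' by simp
    moreover have "card (P - c) < card P"
      using P.cycle_nonempty[OF c] P.cycle_subset[OF c] P.fin by (intro psubset_card_mono) auto
    ultimately obtain g where g: "block_iso (P - c) \<omega> (Q - c') \<omega>' g"
      using less.hyps Pc.block_perm_axioms Qc.block_perm_axioms by blast
    \<comment> \<open>A single ordering of the common cut partition is fixed, so that both cycles
      are compared with literally the same model.\<close>
    obtain rs where rs: "mset rs = cut_partition \<omega> c" by (metis ex_mset)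
    obtain f1 where f1: "block_iso (model_blocks (card c) rs) (model_succ (card c) rs) c \<omega> f1"
      using P.cycle_iso_model[OF c rs] by auto
    obtain f2 where f2: "block_iso (model_blocks (card c) rs) (model_succ (card c) rs) c' \<omega>' f2"
      using Q.cycle_iso_model[OF c'(1), of rs] c' rs by auto
    have "block_iso c \<omega> c' \<omega>' (f2 \<circ> inv_into (\<Union>(model_blocks (card c) rs)) f1)"
      using block_iso_comp[OF block_iso_inv[OF f1 model_succ_maps] f2] by blast
    from block_iso_glue[OF this g] have "\<exists>h. block_iso (c \<union> (P - c)) \<omega> (c' \<union> (Q - c')) \<omega>' h"
      using P.cycle_maps[OF c] Pc.maps P.Union_disjoint[of c "P - c"] Q.Union_disjoint[of c' "Q - c'"]
        P.cycle_subset[OF c] Q.cycle_subset[OF c'(1)]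
      by blast
    moreover have "c \<union> (P - c) = P" "c' \<union> (Q - c') = Q"
      using P.cycle_subset[OF c] Q.cycle_subset[OF c'(1)] by auto
    ultimately show ?thesis by simp
  qed
qed

section \<open>Realization of every family as a type\<close>

lemma block_perm_model:
  assumes "0 < m" "0 < k" "sum_list rs = k"
  shows "block_perm k (model_blocks m rs) (model_succ m rs)"
proof
  show "inj_on (model_succ m rs) (\<Union>(model_blocks m rs))"
    using assms by (simp add: Union_model_blocks inj_on_model_succ)
next
  fix p q x assume "p \<in> model_blocks m rs" "q \<in> model_blocks m rs" "x \<in> p" "x \<in> q"
  then show "p = q" by (auto simp: model_blocks_def model_block_def)
next
  fix p assume "p \<in> model_blocks m rs"
  then show "card p = k" using assms by (auto simp: model_blocks_def card_model_block)
qed (use assms model_succ_maps in \<open>auto simp: model_blocks_def\<close>)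

text \<open>Each positive part yields one cycle, the full arc over its index, and this arc meets the
  class of residue 0 in the multiples of m below \<open>m * rs ! i\<close>. A part 0 would have an
  empty arc and vanish from the type, which is why \<open>pos\<close> is assumed.\<close>

lemma block_type_model:
  assumes m: "0 < m" and k: "0 < k" "sum_list rs = k" and pos: "0 \<notin> set rs"
  shows "block_type (model_blocks m rs) (model_succ m rs) =
    (\<lambda>\<rho>. if \<rho> = mset rs then {#m#} else {#})"
proof -
  interpret block_perm k "model_blocks m rs" "model_succ m rs"
    by (rule block_perm_model) fact+
  let ?B = "model_block m rs" and ?s = "model_succ m rs"
  have pow: "((`) ?s ^^ n) (?B 0) = ?B (n mod m)" for n
    using m by (induction n) (auto simp: model_succ_image mod_Suc_eq)
  have "model_blocks m rs \<subseteq> orbit ((`) ?s) (?B 0)"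
  proof
    fix b assume "b \<in> model_blocks m rs"
    then obtain j where j: "j < m" "b = ?B j" by (auto simp: model_blocks_def)
    \<comment> \<open>The summand m keeps the exponent positive when \<open>j\<close> is 0, as
      membership in \<open>orbit\<close> demands.\<close>
    have "b = ((`) ?s ^^ (j + m)) (?B 0)" using j by (simp add: pow del: funpow.simps)
    then show "b \<in> orbit ((`) ?s) (?B 0)" unfolding orbit_altdef using m by (metis (mono_tags, lifting) CollectI add_gr_0)
  qed
  moreover have B0: "?B 0 \<in> model_blocks m rs" using m by (auto simp: model_blocks_def)
  ultimately have "orbit ((`) ?s) (?B 0) = model_blocks m rs"
    using orbit_block_subset by blast
  then have cyc: "model_blocks m rs \<in> block_cycles (model_blocks m rs) ?s"
    using orbit_mem_block_cycles[OF B0] by simp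
  have "inj_on ?B {..<m}"
  proof (rule inj_onI)
    fix i j assume "i \<in> {..<m}" "j \<in> {..<m}" "?B i = ?B j"
    moreover from this have "?B i \<noteq> {}" using block_nonempty by (auto simp: model_blocks_def)
    ultimately show "i = j" by (auto simp: model_block_def)
  qed
  then have card: "card (model_blocks m rs) = m" by (simp add: model_blocks_def card_image)
  define arc where "arc = (\<lambda>i. {i} \<times> {..<m * rs ! i})"
  have orb: "orbit ?s (i, t) = arc i" if t: "t < m * rs ! i" for i t
  proof -
    have pow: "(?s ^^ n) (i, t) = (i, (t + n) mod (m * rs ! i))" for n
      using t by (induction n) (auto simp: model_succ_def mod_Suc_eq)
    have lt: "n mod (m * rs ! i) < m * rs ! i" for n
      using t by (intro mod_less_divisor) linarith
    show ?thesis
    proof (intro equalityI subsetI)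
      fix x assume "x \<in> orbit ?s (i, t)"
      then show "x \<in> arc i" unfolding orbit_altdef using lt by (auto simp: pow arc_def)
    next
      fix x assume "x \<in> arc i"
      then obtain t' where t': "t' < m * rs ! i" "x = (i, t')" by (auto simp: arc_def)
      \<comment> \<open>One extra turn around the arc keeps the subtraction of naturals exact and
        the exponent positive.\<close>
      have "x = (?s ^^ (t' + m * rs ! i - t)) (i, t)" using t t' by (simp add: pow)
      moreover have "0 < t' + m * rs ! i - t" using t by simp
      ultimately show "x \<in> orbit ?s (i, t)" unfolding orbit_altdef by blast
    qed
  qed
  have rs_pos: "0 < rs ! i" if "i < length rs" for i
    using pos that by (metis gr0I nth_mem)
  have "orbit ?s ` \<Union>(model_blocks m rs) = arc ` {..<length rs}"
  proof (intro equalityI subsetI)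
    fix z assume "z \<in> orbit ?s ` \<Union>(model_blocks m rs)"
    then show "z \<in> arc ` {..<length rs}" unfolding Union_model_blocks[OF m] by (auto simp: orb)
  next
    fix z assume "z \<in> arc ` {..<length rs}"
    then obtain i where i: "i < length rs" "z = arc i" by auto
    then have "z = orbit ?s (i, 0)" using rs_pos m by (simp add: orb)
    then show "z \<in> orbit ?s ` \<Union>(model_blocks m rs)"
      unfolding Union_model_blocks[OF m] using i rs_pos m by auto
  qed
  moreover have "inj_on arc {..<length rs}"
  proof (rule inj_onI)
    fix i j assume ij: "i \<in> {..<length rs}" "j \<in> {..<length rs}" "arc i = arc j"
    have "(i, 0) \<in> arc i" using ij(1) rs_pos[of i] m by (simp add: arc_def)
    then have "(i, 0) \<in> arc j" unfolding ij(3) .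
    then show "i = j" by (simp add: arc_def)
  qed
  ultimately have "mset_set (orbit ?s ` \<Union>(model_blocks m rs)) = image_mset arc (mset_set {..<length rs})"
    by (simp add: image_mset_mset_set)
  then have "cut_partition ?s (model_blocks m rs) =
      image_mset (\<lambda>i. card (?B 0 \<inter> arc i)) (mset_set {..<length rs})"
    using cut_partition_eq[OF cyc B0] by (simp add: multiset.map_comp o_def)
  also have "\<dots> = image_mset (\<lambda>i. rs ! i) (mset_set {..<length rs})"
  proof (rule image_mset_cong)
    fix i assume "i \<in># mset_set {..<length rs}"
    then have "?B 0 \<inter> arc i = Pair i ` {t. t < m * rs ! i \<and> t mod m = 0}"
      by (auto simp: model_block_def arc_def)
    then show "card (?B 0 \<inter> arc i) = rs ! i"
      using bij_betw_same_card[OF bij_betw_residue[OF m], of "rs ! i", symmetric]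
      by (simp add: card_image inj_on_def)
  qed
  also have "\<dots> = mset rs"
    by (metis map_nth mset_map mset_upt atLeast0LessThan)
  finally have cut: "cut_partition ?s (model_blocks m rs) = mset rs" .
  show ?thesis unfolding block_type_cycle[OF cyc] cut card ..
qed

text \<open>The classification applied to the two identities gives a block-preserving bijection, and
  \<sigma> is conjugated along it.\<close>

lemma block_perm_transport:
  assumes "block_perm k M \<sigma>" "block_system k P" "card M = card P"
  shows "\<exists>\<omega>. block_perm k P \<omega> \<and> block_type P \<omega> = block_type M \<sigma>"
proof -
  interpret M: block_perm k M \<sigma> by fact
  interpret P: block_system k P by fact
  have "block_type M id = block_type P id"
    unfolding block_type_id[OF M.block_system_axioms] block_type_id[OF assms(2)] assms(3) ..
  then obtain f where f: "block_iso M id P id f"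
    using block_iso_if_block_type_eq[OF block_perm_id[OF M.block_system_axioms] block_perm_id[OF assms(2)]]
    by blast
  let ?g = "inv_into (\<Union>M) f"
  define \<omega> where "\<omega> = f \<circ> \<sigma> \<circ> ?g"
  have g: "block_iso P id M id ?g" using block_iso_inv[OF f] by simp
  have gM: "?g ` p \<in> M" if "p \<in> P" for p using g that by (auto simp: block_iso_def)
  have fP: "f ` q \<in> P" if "q \<in> M" for q using f that by (auto simp: block_iso_def)
  have bijf: "bij_betw f (\<Union>M) (\<Union>P)" and bijg: "bij_betw ?g (\<Union>P) (\<Union>M)"
    using f g by (auto simp: block_iso_def)
  have P: "block_perm k P \<omega>"
  proof
    show "\<omega> ` p \<in> P" if "p \<in> P" for p
      unfolding \<omega>_def image_comp[symmetric] by (intro fP M.maps gM that)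
    have "inj_on (f \<circ> \<sigma>) (\<Union>M)"
    proof (rule comp_inj_on[OF M.inj])
      show "inj_on f (\<sigma> ` \<Union>M)"
        by (rule inj_on_subset[OF bij_betw_imp_inj_on[OF bijf]]) (use M.maps_elem in blast)
    qed
    then show "inj_on \<omega> (\<Union>P)"
      using comp_inj_on[of ?g "\<Union>P" "f \<circ> \<sigma>"] bijg by (simp add: \<omega>_def bij_betw_def)
  qed
  have "f (\<sigma> x) = \<omega> (f x)" if "x \<in> \<Union>M" for x
    using bij_betw_inv_into_left[OF bijf that] by (simp add: \<omega>_def)
  then have "block_iso M \<sigma> P \<omega> f" using f by (simp add: block_iso_def)
  then show ?thesis using block_type_iso[OF assms(1) P] P by blast
qed

lemma block_perm_glue:
  assumes 1: "block_perm k P \<omega>1" and 2: "block_perm k Q \<omega>2"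
    and PQ: "block_system k (P \<union> Q)" "P \<inter> Q = {}"
  defines "\<omega> \<equiv> \<lambda>x. if x \<in> \<Union>P then \<omega>1 x else \<omega>2 x"
  shows "block_perm k (P \<union> Q) \<omega>"
    and "block_type (P \<union> Q) \<omega> \<rho> = block_type P \<omega>1 \<rho> + block_type Q \<omega>2 \<rho>"
proof -
  interpret P: block_perm k P \<omega>1 by fact
  interpret Q: block_perm k Q \<omega>2 by fact
  interpret PQ: block_system k "P \<union> Q" by fact
  have disj: "\<Union>P \<inter> \<Union>Q = {}" using PQ.Union_disjoint[of P Q] PQ(2) by simp
  have e1: "\<omega> x = \<omega>1 x" if "x \<in> \<Union>P" for x using that by (simp add: \<omega>_def)
  have e2: "\<omega> x = \<omega>2 x" if "x \<in> \<Union>Q" for x using that disj by (auto simp: \<omega>_def)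
  have i1: "\<omega> ` p = \<omega>1 ` p" if "p \<in> P" for p
    by (rule image_cong[OF refl], rule e1) (use that in blast)
  have i2: "\<omega> ` p = \<omega>2 ` p" if "p \<in> Q" for p
    by (rule image_cong[OF refl], rule e2) (use that in blast)
  show PQ': "block_perm k (P \<union> Q) \<omega>"
  proof
    show "\<omega> ` p \<in> P \<union> Q" if "p \<in> P \<union> Q" for p
      using that i1 i2 P.maps Q.maps by auto
    have "inj_on \<omega> (\<Union>P)" by (rule inj_on_cong[OF e1, THEN iffD2, OF _ P.inj])
    moreover have "inj_on \<omega> (\<Union>Q)" by (rule inj_on_cong[OF e2, THEN iffD2, OF _ Q.inj])
    moreover have "\<omega> ` \<Union>P \<subseteq> \<Union>P" using e1 P.maps_elem by (metis image_subsetI)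
    moreover have "\<omega> ` \<Union>Q \<subseteq> \<Union>Q" using e2 Q.maps_elem by (metis image_subsetI)
    ultimately show "inj_on \<omega> (\<Union>(P \<union> Q))"
      unfolding Union_Un_distrib inj_on_Un using disj by blast
  qed
  interpret PQ': block_perm k "P \<union> Q" \<omega> by (rule PQ')
  have "block_type (P \<union> Q) \<omega> \<rho> = block_type P \<omega> \<rho> + block_type Q \<omega> \<rho>"
    by (rule PQ'.block_type_Un) (use PQ(2) i1 i2 P.maps Q.maps in auto)
  then show "block_type (P \<union> Q) \<omega> \<rho> = block_type P \<omega>1 \<rho> + block_type Q \<omega>2 \<rho>"
    using block_type_cong[OF 1 e1[symmetric]] block_type_cong[OF 2 e2[symmetric]] by simp
qed

lemma fam_size_remove:
  assumes "\<rho> \<in> partitions_of k" "m \<in># \<Lambda> \<rho>"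
  shows "fam_size k \<Lambda> = m + fam_size k (\<Lambda>(\<rho> := \<Lambda> \<rho> - {#m#}))"
proof -
  let ?L = "\<Lambda>(\<rho> := \<Lambda> \<rho> - {#m#})"
  have "(\<Sum>p\<in>partitions_of k - {\<rho>}. sum_mset (\<Lambda> p)) = (\<Sum>p\<in>partitions_of k - {\<rho>}. sum_mset (?L p))"
    by (rule sum.cong) auto
  moreover have "sum_mset (\<Lambda> \<rho>) = m + sum_mset (\<Lambda> \<rho> - {#m#})"
    using assms(2) by (metis add.commute sum_mset.remove)
  ultimately show ?thesis
    unfolding fam_size_def sum.remove[OF finite_partitions_of assms(1)] by simp
qed

text \<open>Induction on the number of blocks: for some part m of \<Lambda> at \<rho>, a model cycle
  is transported onto m of the blocks, and the rest of the family is realized on the remaining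
  blocks.\<close>

theorem exists_block_type:
  assumes "block_system k P" "\<Lambda> \<in> families k" "fam_size k \<Lambda> = card P"
  shows "\<exists>\<omega>. block_perm k P \<omega> \<and> block_type P \<omega> = \<Lambda>"
  using assms
proof (induction "card P" arbitrary: P \<Lambda> rule: less_induct)
  case less
  interpret P: block_system k P by fact
  show ?case
  proof (cases "\<exists>\<rho>. \<Lambda> \<rho> \<noteq> {#}")
    case False
    then have "\<Lambda> = (\<lambda>_. {#})" by auto
    moreover from this have "P = {}" using less.prems(3) P.fin by (simp add: fam_size_def)
    ultimately show ?thesis
      using block_perm_id[OF less.prems(1)] block_type_id[OF less.prems(1)] by (intro exI[of _ id]) auto
  next
    case True
    then obtain \<rho> m where \<rho>m: "m \<in># \<Lambda> \<rho>" by (metis multiset_nonemptyE)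
    then have \<rho>: "\<rho> \<in> partitions_of k" using less.prems(2) by (force simp: families_def)
    have m: "0 < m" using \<rho>m \<rho> less.prems(2) by (force simp: families_def is_partition_def)
    let ?L = "\<Lambda>(\<rho> := \<Lambda> \<rho> - {#m#})"
    have L: "?L \<in> families k"
      using less.prems(2) \<rho> by (auto simp: families_def is_partition_def dest: in_diffD)
    have size: "card P = m + fam_size k ?L"
      using fam_size_remove[of \<rho> k m \<Lambda>, OF \<rho> \<rho>m] less.prems(3) by simp
    then obtain P1 where P1: "P1 \<subseteq> P" "card P1 = m" by (metis le_add1 obtain_subset_with_card_n)
    have fin1: "finite P1" using P1 P.fin finite_subset by blast
    have cardP2: "fam_size k ?L = card (P - P1)"
      using size P1 fin1 by (simp add: card_Diff_subset)
    have "card (P - P1) < card P" using size cardP2 m by simp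
    from less.hyps[OF this P.block_system_subset L cardP2]
    obtain \<omega>2 where \<omega>2: "block_perm k (P - P1) \<omega>2" "block_type (P - P1) \<omega>2 = ?L" by auto
    obtain rs where rs: "mset rs = \<rho>" by (metis ex_mset)
    have rs': "sum_list rs = k" "0 \<notin> set rs"
      using \<rho> rs by (auto simp: partitions_of_def is_partition_def sum_mset_sum_list)
    have model: "block_perm k (model_blocks m rs) (model_succ m rs)"
      by (rule block_perm_model[OF m P.k_pos rs'(1)])
    have type: "block_type (model_blocks m rs) (model_succ m rs) = (\<lambda>\<rho>'. if \<rho>' = \<rho> then {#m#} else {#})"
      using block_type_model[OF m P.k_pos rs'] rs by simp
    have "card (model_blocks m rs) = card P1"
    proof -
      have "fam_size k (\<lambda>\<rho>'. if \<rho>' = \<rho> then {#m#} else {#}) = m"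
        unfolding fam_size_def using \<rho> finite_partitions_of
        by (simp add: if_distrib[of sum_mset] cong: if_cong)
      then show ?thesis using block_perm.fam_size_block_type[OF model] type P1 by simp
    qed
    then obtain \<omega>1 where \<omega>1: "block_perm k P1 \<omega>1"
        "block_type P1 \<omega>1 = (\<lambda>\<rho>'. if \<rho>' = \<rho> then {#m#} else {#})"
      using block_perm_transport[OF model P.block_system_subset[OF P1(1)]] type by auto
    have U: "P1 \<union> (P - P1) = P" using P1 by auto
    let ?w = "\<lambda>x. if x \<in> \<Union>P1 then \<omega>1 x else \<omega>2 x"
    have "block_perm k P ?w"
      using block_perm_glue(1)[OF \<omega>1(1) \<omega>2(1)] U less.prems(1) by simp
    moreover have "block_type P ?w \<rho>' = \<Lambda> \<rho>'" for \<rho>'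
      using block_perm_glue(2)[OF \<omega>1(1) \<omega>2(1), of \<rho>'] U less.prems(1) \<omega>1(2) \<omega>2(2) \<rho>m by simp
    ultimately show ?thesis by blast
  qed
qed

section \<open>Permutations of k-tuples\<close>

definition tuples :: "nat \<Rightarrow> nat set set" where
  "tuples k = tuple k ` {1..}"

lemma card_tuple: "1 \<le> i \<Longrightarrow> card (tuple k i) = k"
  by (cases i) (auto simp: tuple_def)

lemma tuple_unique:
  assumes "1 \<le> i" "1 \<le> j" "x \<in> tuple k i" "x \<in> tuple k j"
  shows "i = j"
proof -
  have "\<not> i < j" if "1 \<le> j" "x \<in> tuple k i" "x \<in> tuple k j" for i j
  proof
    assume "i < j"
    then have "i * k \<le> (j - 1) * k" by (intro mult_le_mono1) simp
    moreover have "(j - 1) * k + 1 \<le> x" "x \<le> i * k" using that unfolding tuple_def atLeastAtMost_iff by blast+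
    ultimately show False by linarith
  qed
  then show ?thesis using assms by (metis linorder_neqE_nat)
qed

lemma tuples_unique: "p \<in> tuples k \<Longrightarrow> q \<in> tuples k \<Longrightarrow> x \<in> p \<Longrightarrow> x \<in> q \<Longrightarrow> p = q"
  using tuple_unique by (auto simp: tuples_def)

lemma tuples_nonempty: "1 \<le> k \<Longrightarrow> p \<in> tuples k \<Longrightarrow> p \<noteq> {}"
  by (metis card.empty card_tuple atLeast_iff imageE not_one_le_zero tuples_def)

lemma block_system_tuples:
  assumes "1 \<le> k" "finite P" "P \<subseteq> tuples k"
  shows "block_system k P"
proof
  fix p q x assume "p \<in> P" "q \<in> P" "x \<in> p" "x \<in> q"
  then show "p = q" using assms tuples_unique by blast
next
  fix p assume "p \<in> P"
  then show "card p = k" using assms card_tuple by (auto simp: tuples_def)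
qed (use assms in auto)

text \<open>A tuple inside the union has a point, and disjointness makes it one of the given tuples.
  For \<open>k = 0\<close> all tuples are empty and the set \<open>P\<close> cannot be recovered
  from its union.\<close>

lemma tuples_in_Union:
  assumes "1 \<le> k" "P \<subseteq> tuples k"
  shows "tuples_in k (\<Union>P) = P"
proof -
  have "tuples_in k (\<Union>P) = {p \<in> tuples k. p \<subseteq> \<Union>P}"
    by (auto simp: tuples_in_def tuples_def)
  moreover have "p \<in> P" if p: "p \<in> tuples k" "p \<subseteq> \<Union>P" for p
  proof -
    obtain x where "x \<in> p" using tuples_nonempty[OF assms(1) p(1)] by blast
    moreover from this obtain q where "q \<in> P" "x \<in> q" using p by blast
    ultimately show ?thesis using tuples_unique[of p k q x] p assms by blast
  qed
  ultimately show ?thesis using assms(2) by blast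
qed

lemma Union_tuples_inject:
  assumes "1 \<le> k" "P \<subseteq> tuples k" "Q \<subseteq> tuples k" "\<Union>P = \<Union>Q"
  shows "P = Q"
  using tuples_in_Union[OF assms(1,2)] tuples_in_Union[OF assms(1,3)] unfolding assms(4) by simp

lemma tuple_union_iff: "tuple_union k d \<longleftrightarrow> (\<exists>P. finite P \<and> P \<subseteq> tuples k \<and> d = \<Union>P)"
proof
  assume "tuple_union k d"
  then obtain I where "finite I" "I \<subseteq> {1..}" "d = (\<Union>i\<in>I. tuple k i)"
    by (auto simp: tuple_union_def)
  then show "\<exists>P. finite P \<and> P \<subseteq> tuples k \<and> d = \<Union>P"
    by (intro exI[of _ "tuple k ` I"]) (auto simp: tuples_def)
next
  assume "\<exists>P. finite P \<and> P \<subseteq> tuples k \<and> d = \<Union>P"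
  then obtain P where P: "finite P" "P \<subseteq> tuple k ` {1..}" "d = \<Union>P" by (auto simp: tuples_def)
  from finite_subset_image[OF P(1,2)] obtain I where "I \<subseteq> {1..}" "finite I" "P = tuple k ` I" by blast
  then show "tuple_union k d" using P(3) unfolding tuple_union_def by blast
qed

text \<open>This is the passage from tuples to blocks: on the finite set \<open>\<Union>P\<close> an
  injective self-map is bijective, so together with the identity outside it is a
  permutation.\<close>

lemma B_perms_iff:
  assumes k: "1 \<le> k" and P: "finite P" "P \<subseteq> tuples k"
  shows "\<omega> \<in> B_perms k (\<Union>P) \<longleftrightarrow> block_perm k P \<omega> \<and> (\<forall>x. x \<notin> \<Union>P \<longrightarrow> \<omega> x = x)"
proof -
  interpret block_system k P by (rule block_system_tuples[OF k P])
  show ?thesis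
  proof (intro iffI conjI)
    assume "\<omega> \<in> B_perms k (\<Union>P)"
    then have \<omega>: "\<omega> permutes \<Union>P" "\<And>p. p \<in> P \<Longrightarrow> \<omega> ` p \<in> P"
      unfolding B_perms_def tuples_in_Union[OF k P(2)] by auto
    show "block_perm k P \<omega>"
      by unfold_locales (use \<omega> permutes_inj_on in auto)
    show "\<forall>x. x \<notin> \<Union>P \<longrightarrow> \<omega> x = x" using \<omega>(1) by (meson permutes_not_in)
  next
    assume *: "block_perm k P \<omega> \<and> (\<forall>x. x \<notin> \<Union>P \<longrightarrow> \<omega> x = x)"
    then interpret block_perm k P \<omega> by blast
    have "\<omega> ` \<Union>P \<subseteq> \<Union>P" using maps_elem by blast
    then have "bij_betw \<omega> (\<Union>P) (\<Union>P)"
      using inj fin_Union by (simp add: bij_betw_def endo_inj_surj)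
    then have "\<omega> permutes \<Union>P" by (rule bij_imp_permutes) (use * in blast)
    then show "\<omega> \<in> B_perms k (\<Union>P)"
      unfolding B_perms_def tuples_in_Union[OF k P(2)] using maps by blast
  qed
qed

lemma perm_type_eq:
  assumes "1 \<le> k" "P \<subseteq> tuples k"
  shows "perm_type k (\<Union>P) \<omega> = block_type P \<omega>"
proof -
  have "tuple_cycles k (\<Union>P) \<omega> = block_cycles P \<omega>"
    unfolding tuple_cycles_def block_cycles_def tuples_in_Union[OF assms] by auto
  moreover have "cycle_partition \<omega> c = cut_partition \<omega> c" for c
    unfolding cycle_partition_def cut_partition_def Let_def Setcompr_eq_image ..
  ultimately show ?thesis by (simp add: perm_type_def block_type_def)
qed

lemma partial_class_iff:
  assumes "1 \<le> k"
  shows "(d, \<omega>) \<in> partial_class k \<Lambda> \<longleftrightarrow>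
    (\<exists>P. finite P \<and> P \<subseteq> tuples k \<and> d = \<Union>P \<and> \<omega> \<in> B_perms k (\<Union>P) \<and> block_type P \<omega> = \<Lambda>)"
  unfolding partial_class_def partial_perms_def
  using perm_type_eq[OF assms] by (auto simp: tuple_union_iff)

text \<open>Enlarging the domain adds pointwise fixed tuples, each of them a cycle of length 1 that
  is cut into singletons.\<close>

lemma B_perms_mono:
  assumes k: "1 \<le> k" and Q: "finite Q" "Q \<subseteq> tuples k" and PQ: "P \<subseteq> Q" and \<omega>: "\<omega> \<in> B_perms k (\<Union>P)"
  shows "\<omega> \<in> B_perms k (\<Union>Q)"
    and "block_type Q \<omega> \<rho> =
      block_type P \<omega> \<rho> + (if \<rho> = ones k then replicate_mset (card Q - card P) 1 else {#})"
proof -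
  have P: "finite P" "P \<subseteq> tuples k" using Q PQ finite_subset by auto
  have \<omega>': "block_perm k P \<omega>" "\<And>x. x \<notin> \<Union>P \<Longrightarrow> \<omega> x = x"
    using \<omega> unfolding B_perms_iff[OF k P] by auto
  interpret P: block_perm k P \<omega> by (rule \<omega>')
  interpret Q: block_system k Q by (rule block_system_tuples[OF k Q])
  have fixed: "\<omega> x = id x" if "x \<in> \<Union>(Q - P)" for x
    using \<omega>'(2) that Q.Union_disjoint[of P "Q - P"] PQ by auto
  have img: "\<omega> ` q = q" if "q \<in> Q - P" for q
  proof -
    have "\<omega> ` q = id ` q"
      by (rule image_cong[OF refl], rule fixed) (use that in blast)
    then show ?thesis by simp
  qed
  have maps: "\<omega> ` q \<in> Q" if "q \<in> Q" for q using that img P.maps PQ by (cases "q \<in> P") auto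
  have "\<omega> permutes \<Union>P" using \<omega> by (simp add: B_perms_def)
  then have inj: "inj_on \<omega> (\<Union>Q)" by (rule permutes_inj_on)
  interpret Q: block_perm k Q \<omega> by unfold_locales (use maps inj in auto)
  show "\<omega> \<in> B_perms k (\<Union>Q)"
    unfolding B_perms_iff[OF k Q] using Q.block_perm_axioms \<omega>'(2) PQ by blast
  have R: "block_system k (Q - P)" by (rule Q.block_system_subset) blast
  have "block_type (Q - P) \<omega> = block_type (Q - P) id"
    by (rule block_type_cong[OF block_perm_id[OF R]]) (use fixed in auto)
  moreover have "card (Q - P) = card Q - card P" using PQ P(1) by (simp add: card_Diff_subset)
  moreover have "block_type Q \<omega> \<rho> = block_type P \<omega> \<rho> + block_type (Q - P) \<omega> \<rho>"
    by (rule Q.block_type_Un) (use PQ P.maps img in auto)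
  ultimately show "block_type Q \<omega> \<rho> =
      block_type P \<omega> \<rho> + (if \<rho> = ones k then replicate_mset (card Q - card P) 1 else {#})"
    by (simp add: block_type_id[OF R])
qed

lemma block_type_families:
  assumes "1 \<le> k" "finite P" "P \<subseteq> tuples k" "\<omega> \<in> B_perms k (\<Union>P)"
  shows "block_type P \<omega> \<in> families k" "fam_size k (block_type P \<omega>) = card P"
  using assms(4) unfolding B_perms_iff[OF assms(1-3)]
  by (auto simp: block_perm.block_type_families block_perm.fam_size_block_type)

lemma block_type_extend:
  assumes "1 \<le> k" "finite Q" "Q \<subseteq> tuples k" "P \<subseteq> Q" "\<omega> \<in> B_perms k (\<Union>P)"
  shows "block_type Q \<omega> = complete_to k (card Q) (block_type P \<omega>)"
proof -
  have "finite P" "P \<subseteq> tuples k" using assms finite_subset by auto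
  then have "fam_size k (block_type P \<omega>) = card P" using assms block_type_families by blast
  then show ?thesis using B_perms_mono(2)[OF assms] by (auto simp: complete_to_def)
qed

section \<open>Moved tuples and proper types\<close>

definition moved_tuples :: "nat \<Rightarrow> (nat \<Rightarrow> nat) \<Rightarrow> nat set set" where
  "moved_tuples k \<omega> = {p \<in> tuples k. \<exists>x\<in>p. \<omega> x \<noteq> x}"

lemma moved_tuples_subset:
  assumes "P \<subseteq> tuples k" "\<omega> \<in> B_perms k (\<Union>P)"
  shows "moved_tuples k \<omega> \<subseteq> P"
proof
  fix p assume "p \<in> moved_tuples k \<omega>"
  then obtain x where x: "p \<in> tuples k" "x \<in> p" "\<omega> x \<noteq> x" by (auto simp: moved_tuples_def)
  then have "x \<in> \<Union>P" using assms(2) by (auto simp: B_perms_def permutes_def)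
  then show "p \<in> P" using x assms(1) tuples_unique by blast
qed

text \<open>By injectivity the image of a moved point is moved again, so \<omega> permutes its moved
  tuples among themselves. They depend on \<omega> alone and form its smallest possible
  domain.\<close>

lemma B_perms_moved:
  assumes k: "1 \<le> k" and P: "finite P" "P \<subseteq> tuples k" and \<omega>: "\<omega> \<in> B_perms k (\<Union>P)"
  shows "\<omega> \<in> B_perms k (\<Union>(moved_tuples k \<omega>))"
proof -
  let ?M = "moved_tuples k \<omega>"
  interpret P: block_perm k P \<omega> using \<omega> unfolding B_perms_iff[OF k P] by auto
  have MP: "?M \<subseteq> P" by (rule moved_tuples_subset[OF P(2) \<omega>])
  have M: "finite ?M" "?M \<subseteq> tuples k" using MP P finite_subset by auto
  have "\<omega> ` p \<in> ?M" if p: "p \<in> ?M" for p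
  proof -
    have "\<omega> ` p \<in> P" using p MP P.maps by blast
    then have "\<omega> ` p \<in> tuples k" using P(2) by blast
    moreover obtain x where x: "x \<in> p" "\<omega> x \<noteq> x" using p by (auto simp: moved_tuples_def)
    moreover have "\<omega> (\<omega> x) \<noteq> \<omega> x"
      using x \<omega> by (auto simp: B_perms_def dest: permutes_inj injD)
    ultimately show ?thesis by (auto simp: moved_tuples_def)
  qed
  then have "block_perm k ?M \<omega>" by (intro P.block_perm_subset MP)
  moreover have "\<omega> x = x" if "x \<notin> \<Union>?M" for x
  proof (rule ccontr)
    assume "\<omega> x \<noteq> x"
    moreover from this have "x \<in> \<Union>P" using \<omega> unfolding B_perms_iff[OF k P] by auto
    ultimately show False using that P(2) by (auto simp: moved_tuples_def)
  qed
  ultimately show ?thesis unfolding B_perms_iff[OF k M] by blast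
qed

text \<open>A part 1 at \<open>ones k\<close> comes from a tuple that \<omega> maps to itself and
  whose points lie in different cycles of \<omega>, that is, from a pointwise fixed tuple.\<close>

lemma proper_moved:
  assumes k: "1 \<le> k" and P: "finite P" "P \<subseteq> tuples k" and \<omega>: "\<omega> \<in> B_perms k (\<Union>P)"
    and moved: "moved_tuples k \<omega> = P"
  shows "proper k (block_type P \<omega>)"
  unfolding proper_def
proof
  interpret P: block_perm k P \<omega> using \<omega> unfolding B_perms_iff[OF k P] by auto
  assume "1 \<in># block_type P \<omega> (ones k)"
  then obtain c where c: "c \<in> block_cycles P \<omega>" "card c = 1" "cut_partition \<omega> c = ones k"
    using P.finite_block_cycles by (auto simp: block_type_def)
  then obtain p where p: "c = {p}" by (metis card_1_singletonE)
  have pP: "p \<in> P" using P.cycle_subset[OF c(1)] p by auto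
  have "\<omega> x = x" if x: "x \<in> p" for x
  proof -
    have "finite (orbit \<omega> ` p)" using pP P.fin_block by simp
    then have "card (p \<inter> orbit \<omega> x) \<in># cut_partition \<omega> c"
      using P.cut_partition_eq[OF c(1), of p] p x by simp
    then have "card (p \<inter> orbit \<omega> x) = 1" unfolding c(3) ones_def by (simp split: if_splits)
    moreover have "x \<in> p \<inter> orbit \<omega> x" using x pP P.self_orbit by blast
    moreover have "\<omega> x \<in> p \<inter> orbit \<omega> x"
      using P.cycle_maps[OF c(1), of p] p x by (auto intro: orbit.base)
    ultimately show ?thesis by (metis card_1_singletonE singletonD)
  qed
  then show False using pP moved by (auto simp: moved_tuples_def)
qed

text \<open>Any tuple of the domain beyond the moved ones would contribute a part 1 at
  \<open>ones k\<close>.\<close>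

lemma moved_if_proper:
  assumes k: "1 \<le> k" and P: "finite P" "P \<subseteq> tuples k" and \<omega>: "\<omega> \<in> B_perms k (\<Union>P)"
    and proper: "proper k (block_type P \<omega>)"
  shows "moved_tuples k \<omega> = P"
proof -
  have MP: "moved_tuples k \<omega> \<subseteq> P" by (rule moved_tuples_subset[OF P(2) \<omega>])
  have "card P - card (moved_tuples k \<omega>) = 0"
  proof (rule ccontr)
    assume "card P - card (moved_tuples k \<omega>) \<noteq> 0"
    then have "1 \<in># block_type P \<omega> (ones k)"
      unfolding B_perms_mono(2)[OF k P MP B_perms_moved[OF k P \<omega>]] by simp
    then show False using proper by (simp add: proper_def)
  qed
  then show ?thesis using MP P(1) by (intro card_seteq) auto
qed

text \<open>The type on \<open>P\<close> is written as a proper family plus ones in two ways, from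
  \<Lambda> and from the moved tuples; a proper family has no ones of its own, so the decomposition
  is unique.\<close>

lemma block_type_moved:
  assumes k: "1 \<le> k" and P: "finite P" "P \<subseteq> tuples k" and \<omega>: "\<omega> \<in> B_perms k (\<Union>P)"
    and type: "block_type P \<omega> = complete_to k n \<Lambda>" and proper: "proper k \<Lambda>"
  shows "block_type (moved_tuples k \<omega>) \<omega> = \<Lambda>"
proof -
  let ?M = "moved_tuples k \<omega>"
  have MP: "?M \<subseteq> P" by (rule moved_tuples_subset[OF P(2) \<omega>])
  have M: "finite ?M" "?M \<subseteq> tuples k" using MP P finite_subset by auto
  have \<omega>M: "\<omega> \<in> B_perms k (\<Union>?M)" by (rule B_perms_moved[OF k P \<omega>])
  have pM: "proper k (block_type ?M \<omega>)" by (rule proper_moved[OF k M \<omega>M refl])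
  have eq: "\<Lambda> \<rho> + (if \<rho> = ones k then replicate_mset (n - fam_size k \<Lambda>) 1 else {#}) =
      block_type ?M \<omega> \<rho> + (if \<rho> = ones k then replicate_mset (card P - card ?M) 1 else {#})" for \<rho>
    using fun_cong[OF type, of \<rho>] unfolding B_perms_mono(2)[OF k P MP \<omega>M]
    by (simp add: complete_to_def)
  \<comment> \<open>Counting the parts 1 at \<open>ones k\<close> on both sides sees only the added
    ones.\<close>
  have "n - fam_size k \<Lambda> = card P - card ?M"
    using arg_cong[OF eq[of "ones k"], of "\<lambda>m. count m 1"] proper pM
    by (simp add: proper_def not_in_iff)
  then have "block_type ?M \<omega> \<rho> = \<Lambda> \<rho>" for \<rho>
    using eq[of \<rho>] by (simp split: if_splits)
  then show ?thesis by (rule ext)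
qed

lemma B_perms_conj:
  assumes k: "1 \<le> k" and Q: "finite Q" "Q \<subseteq> tuples k" and \<pi>: "\<pi> \<in> B_perms k (\<Union>Q)"
    and PQ: "P \<subseteq> Q" and \<omega>: "\<omega> \<in> B_perms k (\<Union>P)"
  defines "P' \<equiv> (`) \<pi> ` P" and "\<omega>' \<equiv> \<pi> \<circ> \<omega> \<circ> inv_into UNIV \<pi>"
  shows "P' \<subseteq> Q" "\<pi> ` \<Union>P = \<Union>P'" "\<omega>' \<in> B_perms k (\<Union>P')" "block_type P' \<omega>' = block_type P \<omega>"
proof -
  have P: "finite P" "P \<subseteq> tuples k" using Q PQ finite_subset by auto
  interpret Q: block_perm k Q \<pi> using \<pi> unfolding B_perms_iff[OF k Q] by auto
  interpret P: block_perm k P \<omega> using \<omega> unfolding B_perms_iff[OF k P] by auto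
  have perm: "\<pi> permutes \<Union>Q" using \<pi> by (simp add: B_perms_def)
  have perm\<omega>: "\<omega> permutes \<Union>P" using \<omega> by (simp add: B_perms_def)
  have inv: "inv_into UNIV \<pi> (\<pi> x) = x" "\<pi> (inv_into UNIV \<pi> x) = x" for x using permutes_inverses[OF perm] by auto
  have invim: "inv_into UNIV \<pi> ` \<pi> ` p = p" for p using inv by (simp add: image_image)
  show P'Q: "P' \<subseteq> Q" using PQ Q.maps by (auto simp: P'_def)
  show U: "\<pi> ` \<Union>P = \<Union>P'" by (auto simp: P'_def)
  have P': "finite P'" "P' \<subseteq> tuples k" using Q P'Q finite_subset by auto
  interpret P': block_system k P' by (rule block_system_tuples[OF k P'])
  have inj\<omega>': "inj \<omega>'"
    unfolding \<omega>'_def using permutes_inj[OF perm] permutes_inj[OF perm\<omega>] permutes_inj[OF permutes_inv[OF perm]]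
    by (intro inj_compose) auto
  have bp: "block_perm k P' \<omega>'"
  proof
    fix p' assume "p' \<in> P'"
    then obtain p where p: "p \<in> P" "p' = \<pi> ` p" by (auto simp: P'_def)
    have "\<omega>' ` p' = \<pi> ` \<omega> ` p" unfolding p \<omega>'_def image_comp[symmetric] invim ..
    then show "\<omega>' ` p' \<in> P'" using P.maps[OF p(1)] by (simp add: P'_def)
  qed (rule inj_on_subset[OF inj\<omega>'], simp)
  moreover have "\<omega>' x = x" if "x \<notin> \<Union>P'" for x
  proof -
    have "inv_into UNIV \<pi> x \<notin> \<Union>P" using that inv U by (metis image_eqI)
    then have "\<omega> (inv_into UNIV \<pi> x) = inv_into UNIV \<pi> x" using perm\<omega> by (meson permutes_not_in)
    then show ?thesis by (simp add: \<omega>'_def inv)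
  qed
  ultimately show "\<omega>' \<in> B_perms k (\<Union>P')" unfolding B_perms_iff[OF k P'] by blast
  \<comment> \<open>The conjugator is itself the isomorphism. It is taken from a larger
    \<open>Q\<close> because it may move the domain \<open>P\<close> to a different one.\<close>
  have "block_iso P \<omega> P' \<omega>' \<pi>"
    unfolding block_iso_def bij_betw_def
    using permutes_inj_on[OF perm] U by (auto simp: P'_def \<omega>'_def inv)
  then show "block_type P' \<omega>' = block_type P \<omega>"
    by (rule block_type_iso[OF P.block_perm_axioms bp])
qed

text \<open>An isomorphism between the two domains need not be a permutation of anything. Within the
  union of the domains, each complement is fixed pointwise by its own permutation and the
  complements have equal size, so any block bijection between them completes the isomorphism to a
  conjugator.\<close>

lemma B_perms_conj_exists:
  assumes k: "1 \<le> k" and P: "finite P" "P \<subseteq> tuples k" "\<omega> \<in> B_perms k (\<Union>P)"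
    and P': "finite P'" "P' \<subseteq> tuples k" "\<omega>' \<in> B_perms k (\<Union>P')"
    and type: "block_type P \<omega> = block_type P' \<omega>'"
  shows "\<exists>\<pi>\<in>B_perms k (\<Union>(P \<union> P')). (`) \<pi> ` P = P' \<and> \<omega>' = \<pi> \<circ> \<omega> \<circ> inv_into UNIV \<pi>"
proof -
  let ?Q = "P \<union> P'"
  have Q: "finite ?Q" "?Q \<subseteq> tuples k" using P P' by auto
  interpret P: block_perm k P \<omega> using P(3) unfolding B_perms_iff[OF k P(1,2)] by auto
  interpret P': block_perm k P' \<omega>' using P'(3) unfolding B_perms_iff[OF k P'(1,2)] by auto
  interpret Q: block_system k ?Q by (rule block_system_tuples[OF k Q])
  interpret R: block_system k "?Q - P" by (rule Q.block_system_subset) blast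
  interpret R': block_system k "?Q - P'" by (rule Q.block_system_subset) blast
  have "card P = card P'"
    using P.fam_size_block_type P'.fam_size_block_type type by simp
  then have cards: "card (?Q - P) = card (?Q - P')" using P(1) P'(1) by (simp add: card_Diff_subset)
  obtain f where f: "block_iso P \<omega> P' \<omega>' f"
    using block_iso_if_block_type_eq[OF P.block_perm_axioms P'.block_perm_axioms type] by blast
  \<comment> \<open>The identities on the leftover tuples have equal type, so the classification
    yields the missing bijection.\<close>
  have "block_type (?Q - P) id = block_type (?Q - P') id"
    unfolding block_type_id[OF R.block_system_axioms] block_type_id[OF R'.block_system_axioms] cards ..
  then obtain g where g0: "block_iso (?Q - P) id (?Q - P') id g"
    using block_iso_if_block_type_eq[OF block_perm_id[OF R.block_system_axioms]
        block_perm_id[OF R'.block_system_axioms]] by blast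
  have g: "block_iso (?Q - P) \<omega> (?Q - P') \<omega>' g"
  proof -
    have "\<omega> x = x" if "x \<in> \<Union>(?Q - P)" for x
      using P(3) that Q.Union_disjoint[of P "?Q - P"] unfolding B_perms_iff[OF k P(1,2)] by blast
    moreover have "\<omega>' x = x" if "x \<in> \<Union>(?Q - P')" for x
      using P'(3) that Q.Union_disjoint[of P' "?Q - P'"] unfolding B_perms_iff[OF k P'(1,2)] by blast
    moreover have "g x \<in> \<Union>(?Q - P')" if "x \<in> \<Union>(?Q - P)" for x
      using g0 that unfolding block_iso_def by (meson bij_betw_apply)
    ultimately show ?thesis using g0 unfolding block_iso_def by simp
  qed
  define h where "h = (\<lambda>x. if x \<in> \<Union>P then f x else g x)"
  have img: "\<omega> ` p = p" if "p \<in> ?Q - P" for p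
  proof -
    have "\<omega> x = x" if "x \<in> p" for x
      using P(3) that \<open>p \<in> ?Q - P\<close> Q.Union_disjoint[of P "?Q - P"]
      unfolding B_perms_iff[OF k P(1,2)] by blast
    then show ?thesis by simp
  qed
  have "block_iso (P \<union> (?Q - P)) \<omega> (P' \<union> (?Q - P')) \<omega>' h"
    unfolding h_def
    by (rule block_iso_glue[OF f g])
       (use Q.Union_disjoint[of P "?Q - P"] Q.Union_disjoint[of P' "?Q - P'"] P.maps img in auto)
  moreover have "P \<union> (?Q - P) = ?Q" "P' \<union> (?Q - P') = ?Q" by auto
  ultimately have h: "block_iso ?Q \<omega> ?Q \<omega>' h" by simp
  \<comment> \<open>The glued map \<open>h\<close> is arbitrary off the union, whereas an element of
    \<open>B_perms\<close> is the identity there.\<close>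
  define \<pi> where "\<pi> = perm_restrict h (\<Union>?Q)"
  have eq: "\<pi> x = h x" if "x \<in> \<Union>?Q" for x using that unfolding \<pi>_def by (rule perm_restrict_simps(1))
  have off: "\<pi> x = x" if "x \<notin> \<Union>?Q" for x using that unfolding \<pi>_def by (rule perm_restrict_simps(2))
  have hQ: "bij_betw h (\<Union>?Q) (\<Union>?Q)" "(`) h ` ?Q = ?Q"
    and hcomm: "\<And>x. x \<in> \<Union>?Q \<Longrightarrow> h (\<omega> x) = \<omega>' (h x)"
    using h unfolding block_iso_def by blast+
  have pim: "\<pi> ` p = h ` p" if "p \<in> ?Q" for p
    by (rule image_cong[OF refl], rule eq) (use that in blast)
  have "inj_on \<pi> (\<Union>?Q)"
    by (rule inj_on_cong[OF eq, THEN iffD2, OF _ bij_betw_imp_inj_on[OF hQ(1)]])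
  moreover have "\<pi> ` p \<in> ?Q" if "p \<in> ?Q" for p
    unfolding pim[OF that] using hQ(2) that by blast
  ultimately have "block_perm k ?Q \<pi>" by unfold_locales
  then have \<pi>: "\<pi> \<in> B_perms k (\<Union>?Q)" unfolding B_perms_iff[OF k Q] using off by blast
  then have perm: "\<pi> permutes \<Union>?Q" by (simp add: B_perms_def)
  have "\<pi> ` p = f ` p" if "p \<in> P" for p
  proof -
    have "h ` p = f ` p" by (rule image_cong[OF refl]) (use that in \<open>auto simp: h_def\<close>)
    then show ?thesis using pim that by simp
  qed
  then have "(`) \<pi> ` P = P'" using f by (auto simp: block_iso_def)
  moreover have "\<omega>' (\<pi> x) = \<pi> (\<omega> x)" for x
  proof (cases "x \<in> \<Union>?Q")
    case True
    have \<omega>Q: "\<omega> \<in> B_perms k (\<Union>?Q)" by (rule B_perms_mono(1)[OF k Q _ P(3)]) simp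
    then have "\<omega> x \<in> \<Union>?Q" using True by (metis (no_types, lifting) B_perms_def CollectD permutes_in_image)
    then show ?thesis using hcomm[OF True] eq[OF True] eq[of "\<omega> x"] by simp
  next
    case False
    then have "\<omega> x = x" "\<omega>' x = x"
      using P(3) P'(3) unfolding B_perms_iff[OF k P(1,2)] B_perms_iff[OF k P'(1,2)] by auto
    then show ?thesis using off[OF False] by simp
  qed
  then have "\<omega>' = \<pi> \<circ> \<omega> \<circ> inv_into UNIV \<pi>"
    using permutes_inverses(1)[OF perm] by (metis (no_types, lifting) comp_apply ext)
  ultimately show ?thesis using \<pi> by blast
qed

lemma exists_B_perm:
  assumes k: "1 \<le> k" and P: "finite P" "P \<subseteq> tuples k" and \<Lambda>: "\<Lambda> \<in> families k" "fam_size k \<Lambda> = card P"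
  shows "\<exists>\<omega>\<in>B_perms k (\<Union>P). block_type P \<omega> = \<Lambda>"
proof -
  obtain \<omega> where \<omega>: "block_perm k P \<omega>" "block_type P \<omega> = \<Lambda>"
    using exists_block_type[OF block_system_tuples[OF k P] \<Lambda>] by blast
  let ?w = "perm_restrict \<omega> (\<Union>P)"
  interpret block_perm k P \<omega> by fact
  have eq: "\<omega> x = ?w x" if "x \<in> \<Union>P" for x using that by (simp add: perm_restrict_def)
  have "?w ` p = \<omega> ` p" if "p \<in> P" for p
    by (rule image_cong[OF refl], rule eq[symmetric]) (use that in blast)
  then have "block_perm k P ?w"
    by unfold_locales (simp add: maps, rule inj_on_cong[OF eq, THEN iffD1, OF _ inj])
  then have "?w \<in> B_perms k (\<Union>P)"
    unfolding B_perms_iff[OF k P] by (simp add: perm_restrict_def)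
  moreover have "block_type P ?w = \<Lambda>" using block_type_cong[OF \<omega>(1) eq] \<omega>(2) by simp
  ultimately show ?thesis by blast
qed

lemma Union_tuples_interval: "\<Union>(tuple k ` {1..n}) = {1..k * n}"
proof (induction n)
  case (Suc n)
  have "{1..Suc n} = insert (Suc n) {1..n}" by auto
  then have "\<Union>(tuple k ` {1..Suc n}) = tuple k (Suc n) \<union> {1..k * n}" using Suc by simp
  also have "\<dots> = {1..k * Suc n}" by (auto simp: tuple_def mult.commute)
  finally show ?case .
qed simp

lemma card_tuples_interval: "1 \<le> k \<Longrightarrow> card (tuple k ` {1..n}) = n"
proof -
  assume k: "1 \<le> k"
  have "inj_on (tuple k) {1..n}"
  proof (rule inj_onI)
    fix i j assume ij: "i \<in> {1..n}" "j \<in> {1..n}" "tuple k i = tuple k j"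
    then have "tuple k i \<in> tuples k" by (auto simp: tuples_def)
    then obtain x where "x \<in> tuple k i" using tuples_nonempty[OF k] by blast
    then show "i = j" using ij tuple_unique[of i j x k] by simp
  qed
  then show ?thesis by (simp add: card_image)
qed

section \<open>Structure coefficients as numbers of factorizations\<close>

text \<open>Evaluation at a point of a class isolates the coefficient of that class, because the
  classes are disjoint; nonemptiness thus gives uniqueness in the definite description. Existence
  says that the product is constant on classes, zero outside them and supported on finitely many.
  The closure hypotheses serve to evaluate \<open>finsum\<close> pointwise.\<close>

lemma structure_coeff_eq:
  fixes A :: "(complex, 'x \<Rightarrow> complex) module"
  assumes ops: "add A = (\<lambda>f g x. f x + g x)" "zero A = (\<lambda>_. 0)" "smult A = (\<lambda>a f x. a * f x)"
    and add_closed: "\<And>f g. f \<in> carrier A \<Longrightarrow> g \<in> carrier A \<Longrightarrow> (\<lambda>x. f x + g x) \<in> carrier A"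
    and zero_closed: "(\<lambda>_. 0) \<in> carrier A"
    and smult_closed: "\<And>a f. f \<in> carrier A \<Longrightarrow> (\<lambda>x. a * f x) \<in> carrier A"
    and basis: "\<And>l. l \<in> I \<Longrightarrow> sum_of (C l) \<in> carrier A"
    and nonempty: "\<And>l. l \<in> I \<Longrightarrow> C l \<noteq> {}"
    and disjoint: "\<And>l l' x. l \<in> I \<Longrightarrow> l' \<in> I \<Longrightarrow> x \<in> C l \<Longrightarrow> x \<in> C l' \<Longrightarrow> l = l'"
    and prod: "\<And>l x. l \<in> I \<Longrightarrow> x \<in> C l \<Longrightarrow> (sum_of (C i) \<otimes>\<^bsub>A\<^esub> sum_of (C j)) x = N l"
    and off: "\<And>x. (\<And>l. l \<in> I \<Longrightarrow> x \<notin> C l) \<Longrightarrow> (sum_of (C i) \<otimes>\<^bsub>A\<^esub> sum_of (C j)) x = 0"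
    and fin: "finite {l \<in> I. N l \<noteq> 0}"
    and l: "l \<in> I"
  shows "structure_coeff A I (\<lambda>l. sum_of (C l)) i j l = N l"
proof -
  interpret abelian_monoid A
    by (rule abelian_monoidI) (use add_closed zero_closed in \<open>auto simp: ops add.assoc add.commute\<close>)
  let ?p = "sum_of (C i) \<otimes>\<^bsub>A\<^esub> sum_of (C j)"
  have pointwise: "finsum A f L = (\<lambda>x. \<Sum>l\<in>L. f l x)" if "finite L" "f \<in> L \<rightarrow> carrier A" for f L
    using that
  proof (induction L rule: finite_induct)
    case (insert a L)
    then have "finsum A f (insert a L) = f a \<oplus>\<^bsub>A\<^esub> finsum A f L"
      by (intro finsum_insert) auto
    then show ?case using insert by (simp add: ops)
  qed (simp add: ops)
  have expand: "(\<Oplus>\<^bsub>A\<^esub>l \<in> {l. c l \<noteq> 0}. c l \<odot>\<^bsub>A\<^esub> sum_of (C l)) =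
      (\<lambda>x. \<Sum>l | c l \<noteq> 0. c l * sum_of (C l) x)"
    if "finite {l. c l \<noteq> 0}" "{l. c l \<noteq> 0} \<subseteq> I" for c
    using that basis by (subst pointwise) (auto simp: ops intro!: smult_closed)
  have coeff_at: "(\<Sum>l | c l \<noteq> 0. c l * sum_of (C l) x) = c m"
    if c: "finite {l. c l \<noteq> 0}" "{l. c l \<noteq> 0} \<subseteq> I" and m: "m \<in> I" "x \<in> C m" for c m x
  proof -
    have "(\<Sum>l | c l \<noteq> 0. c l * sum_of (C l) x) = (\<Sum>l | c l \<noteq> 0. if l = m then c m else 0)"
      by (rule sum.cong) (use c m disjoint in \<open>auto simp: sum_of_def\<close>)
    also have "\<dots> = c m" using c(1) by simp
    finally show ?thesis .
  qed
  have zero: "(\<Sum>l | c l \<noteq> 0. c l * sum_of (C l) x) = 0"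
    if "{l. c l \<noteq> 0} \<subseteq> I" "\<And>l. l \<in> I \<Longrightarrow> x \<notin> C l" for c x
    by (rule sum.neutral) (use that in \<open>auto simp: sum_of_def\<close>)
  \<comment> \<open>The description demands a function on all indices with support in
    \<open>I\<close>, hence the extension by 0.\<close>
  define c0 where "c0 = (\<lambda>l. if l \<in> I then N l else 0)"
  have supp: "{l. c0 l \<noteq> 0} = {l \<in> I. N l \<noteq> 0}" by (auto simp: c0_def)
  have "structure_coeff A I (\<lambda>l. sum_of (C l)) i j = c0"
    unfolding structure_coeff_def
  proof (rule the_equality, intro conjI)
    show f: "finite {l. c0 l \<noteq> 0}" and s: "{l. c0 l \<noteq> 0} \<subseteq> I" using fin supp by auto
    show "?p = (\<Oplus>\<^bsub>A\<^esub>l \<in> {l. c0 l \<noteq> 0}. c0 l \<odot>\<^bsub>A\<^esub> sum_of (C l))"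
      unfolding expand[OF f s]
    proof
      fix x
      show "?p x = (\<Sum>l | c0 l \<noteq> 0. c0 l * sum_of (C l) x)"
      proof (cases "\<exists>m\<in>I. x \<in> C m")
        case True
        then obtain m where m: "m \<in> I" "x \<in> C m" by blast
        show ?thesis unfolding coeff_at[OF f s m] prod[OF m] using m by (simp add: c0_def)
      next
        case False
        then show ?thesis using zero[OF s] off by simp
      qed
    qed
  next
    fix c
    assume c: "finite {l. c l \<noteq> 0} \<and> {l. c l \<noteq> 0} \<subseteq> I \<and>
        ?p = (\<Oplus>\<^bsub>A\<^esub>l \<in> {l. c l \<noteq> 0}. c l \<odot>\<^bsub>A\<^esub> sum_of (C l))"
    show "c = c0"
    proof
      fix m
      show "c m = c0 m"
      proof (cases "m \<in> I")
        case True
        then obtain x where x: "x \<in> C m" using nonempty by blast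
        have "?p x = c m" using c expand[of c] coeff_at[of c m x] True x by simp
        then show ?thesis using prod[OF True x] True by (simp add: c0_def)
      next
        case False
        then show ?thesis using c by (auto simp: c0_def)
      qed
    qed
  qed
  then show ?thesis using l by (simp add: c0_def)
qed

definition factorizations :: "('x, 'm) monoid_scheme \<Rightarrow> 'x set \<Rightarrow> 'x set \<Rightarrow> 'x \<Rightarrow> ('x \<times> 'x) set" where
  "factorizations M C D x = {(a, b). a \<in> C \<and> b \<in> D \<and> a \<otimes>\<^bsub>M\<^esub> b = x}"

text \<open>Every factorization within the two sets contributes 1. Finiteness matters because
  \<open>sum\<close> over an infinite index set is 0 by convention.\<close>

lemma convolution_sum_of:
  assumes "C \<subseteq> carrier M" "D \<subseteq> carrier M"
    and "finite {(a, b). a \<in> carrier M \<and> b \<in> carrier M \<and> a \<otimes>\<^bsub>M\<^esub> b = x}"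
  shows "convolution M (sum_of C) (sum_of D) x = of_nat (card (factorizations M C D x))"
proof -
  let ?S = "{(a, b). a \<in> carrier M \<and> b \<in> carrier M \<and> a \<otimes>\<^bsub>M\<^esub> b = x}"
  have sub: "factorizations M C D x \<subseteq> ?S" using assms by (auto simp: factorizations_def)
  have "convolution M (sum_of C) (sum_of D) x = (\<Sum>p\<in>?S. if p \<in> factorizations M C D x then 1 else 0)"
    unfolding convolution_def
    by (rule sum.cong) (auto simp: sum_of_def factorizations_def split: if_splits)
  also have "\<dots> = of_nat (card (factorizations M C D x))"
    using assms(3) sub by (simp add: sum.If_cases Int_absorb1)
  finally show ?thesis .
qed

section \<open>Class sums in the group algebra\<close>

lemma B_perms_comp: "\<omega> \<in> B_perms k d \<Longrightarrow> \<sigma> \<in> B_perms k d \<Longrightarrow> \<omega> \<circ> \<sigma> \<in> B_perms k d"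
  unfolding B_perms_def mem_Collect_eq image_comp[symmetric] by (blast intro: permutes_compose)

lemma B_perms_inv:
  assumes "1 \<le> k" "finite P" "P \<subseteq> tuples k" "\<omega> \<in> B_perms k (\<Union>P)"
  shows "inv_into UNIV \<omega> \<in> B_perms k (\<Union>P)"
proof -
  interpret block_perm k P \<omega> using assms(4) unfolding B_perms_iff[OF assms(1-3)] by auto
  have perm: "\<omega> permutes \<Union>P" using assms(4) by (simp add: B_perms_def)
  have surj: "(`) \<omega> ` P = P" using endo_inj_surj[OF fin _ inj_image] maps by blast
  have "inv_into UNIV \<omega> ` p \<in> P" if "p \<in> P" for p
  proof -
    obtain q where q: "q \<in> P" "p = \<omega> ` q" using surj \<open>p \<in> P\<close> by (metis imageE)
    have "inv_into UNIV \<omega> ` p = q" unfolding q(2) image_image permutes_inverses(2)[OF perm] by simp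
    then show ?thesis using q by simp
  qed
  then show ?thesis
    unfolding B_perms_def tuples_in_Union[OF assms(1,3)] using permutes_inv[OF perm] by blast
qed

lemma finite_B_perms: "finite d \<Longrightarrow> finite (B_perms k d)"
  by (rule finite_subset[of _ "{\<omega>. \<omega> permutes d}"]) (auto simp: B_perms_def finite_permutations)

text \<open>Every such family is the type of some permutation of n tuples, and there are only
  finitely many of these permutations.\<close>

lemma finite_families_of_size:
  assumes k: "1 \<le> k"
  shows "finite {\<Lambda> \<in> families k. fam_size k \<Lambda> = n}"
proof -
  let ?P = "tuple k ` {1..n}"
  have P: "finite ?P" "?P \<subseteq> tuples k" by (auto simp: tuples_def)
  have "finite (\<Union>?P)" unfolding Union_tuples_interval by simp
  then have "finite (block_type ?P ` B_perms k (\<Union>?P))" by (intro finite_imageI finite_B_perms)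
  moreover have "{\<Lambda> \<in> families k. fam_size k \<Lambda> = n} \<subseteq> block_type ?P ` B_perms k (\<Union>?P)"
  proof
    fix \<Lambda> assume "\<Lambda> \<in> {\<Lambda> \<in> families k. fam_size k \<Lambda> = n}"
    then have "\<Lambda> \<in> families k" "fam_size k \<Lambda> = card ?P" by (simp_all only: mem_Collect_eq card_tuples_interval[OF k])
    from exists_B_perm[OF k P this] show "\<Lambda> \<in> block_type ?P ` B_perms k (\<Union>?P)" by blast
  qed
  ultimately show ?thesis by (rule finite_subset[rotated])
qed

context
  fixes k n :: nat and P0 :: "nat set set" and B :: "(nat \<Rightarrow> nat) set"
  assumes k: "1 \<le> k"
  defines "P0 \<equiv> tuple k ` {1..n}" and "B \<equiv> B_perms k {1..k * n}"
begin

lemma P0: "finite P0" "P0 \<subseteq> tuples k" "\<Union>P0 = {1..k * n}" "card P0 = n"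
  unfolding P0_def using Union_tuples_interval card_tuples_interval[OF k] by (auto simp: tuples_def)

lemma B_eq: "B = B_perms k (\<Union>P0)"
  unfolding B_def P0(3) ..

lemma conj_class_eq: "conj_class k n \<Lambda> = {\<omega> \<in> B. block_type P0 \<omega> = \<Lambda>}"
  unfolding conj_class_def B_def P0(3)[symmetric] perm_type_eq[OF k P0(2)] ..

lemma finite_B: "finite B"
  unfolding B_def by (rule finite_B_perms) simp

lemma finite_B_factorizations: "finite {(a, b). a \<in> B \<and> b \<in> B \<and> a \<circ> b = x}"
  by (rule finite_subset[of _ "B \<times> B"]) (use finite_B in auto)

lemma conj_class_conj:
  assumes "\<omega> \<in> conj_class k n \<Lambda>" "\<pi> \<in> B"
  shows "\<pi> \<circ> \<omega> \<circ> inv_into UNIV \<pi> \<in> conj_class k n \<Lambda>"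
proof -
  have \<omega>: "\<omega> \<in> B_perms k (\<Union>P0)" "block_type P0 \<omega> = \<Lambda>"
    using assms(1) unfolding conj_class_eq B_eq by auto
  have \<pi>: "\<pi> \<in> B_perms k (\<Union>P0)" using assms(2) by (simp add: B_eq)
  interpret block_perm k P0 \<pi> using \<pi> unfolding B_perms_iff[OF k P0(1,2)] by auto
  have "(`) \<pi> ` P0 = P0" using endo_inj_surj[OF fin _ inj_image] maps by blast
  then show ?thesis
    using B_perms_conj(3,4)[OF k P0(1,2) \<pi> subset_refl \<omega>(1)] \<omega>(2)
    unfolding conj_class_eq B_eq by simp
qed

text \<open>Conjugation enters twice: class sums are central because classes are invariant under it,
  and the number of factorizations is constant on a class because conjugation transports
  factorizations.\<close>

lemma center_coeff_eq:
  assumes \<Gamma>: "\<Gamma> \<in> families k" "fam_size k \<Gamma> = n" and \<omega>: "\<omega> \<in> conj_class k n \<Gamma>"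
  shows "center_coeff k n \<Lambda> \<Delta> \<Gamma> =
    of_nat (card (factorizations (B_group k {1..k * n}) (conj_class k n \<Lambda>) (conj_class k n \<Delta>) \<omega>))"
proof -
  define G where "G = B_group k {1..k * n}"
  let ?A = "center_of (group_algebra G)"
  let ?C = "conj_class k n"
  let ?F = "\<lambda>\<omega>. factorizations G (?C \<Lambda>) (?C \<Delta>) \<omega>"
  have G: "carrier G = B" "mult G = (\<circ>)" by (simp_all add: B_group_def B_def G_def)
  have mult: "mult ?A = convolution G"
    by (simp add: center_of_def group_algebra_def formal_algebra_def)
  have prod: "(sum_of (?C \<Lambda>) \<otimes>\<^bsub>?A\<^esub> sum_of (?C \<Delta>)) x = of_nat (card (?F x))" for x
    unfolding mult
  proof (rule convolution_sum_of)
    show "?C \<Lambda> \<subseteq> carrier G" "?C \<Delta> \<subseteq> carrier G" unfolding G conj_class_eq by blast+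
    show "finite {(a, b). a \<in> carrier G \<and> b \<in> carrier G \<and> a \<otimes>\<^bsub>G\<^esub> b = x}"
      unfolding G by (rule finite_B_factorizations)
  qed
  have car: "carrier ?A = {z. finite {x. z x \<noteq> 0} \<and> {x. z x \<noteq> 0} \<subseteq> B \<and>
      (\<forall>a. finite {x. a x \<noteq> 0} \<and> {x. a x \<noteq> 0} \<subseteq> B \<longrightarrow> convolution G z a = convolution G a z)}"
    by (auto simp: center_of_def group_algebra_def formal_algebra_def G)
  have conj: "\<pi> \<in> B \<Longrightarrow> inv_into UNIV \<pi> \<in> B" for \<pi> using B_perms_inv[OF k P0(1,2)] by (simp add: B_eq)
  have comp: "\<pi> \<in> B \<Longrightarrow> \<sigma> \<in> B \<Longrightarrow> \<pi> \<circ> \<sigma> \<in> B" for \<pi> \<sigma> unfolding B_def by (rule B_perms_comp)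
  have perm: "\<pi> permutes {1..k * n}" if "\<pi> \<in> B" for \<pi> using that by (simp add: B_def B_perms_def)
  have inv: "\<pi> \<circ> inv_into UNIV \<pi> = id" "inv_into UNIV \<pi> \<circ> \<pi> = id" if "\<pi> \<in> B" for \<pi>
    using permutes_inv_o[OF perm[OF that]] by auto
  have invinv: "inv_into UNIV (inv_into UNIV \<pi>) = \<pi>" if "\<pi> \<in> B" for \<pi>
    by (rule permutes_inv_inv[OF perm[OF that]])
  \<comment> \<open>Since u v = v (v^-1 u v), replacing the pair (u, v) by (v, v^-1 u v) preserves
    the product and keeps the class of the factor weighted by the class sum. This matches the two
    convolutions term by term, for any \<open>a\<close>.\<close>
  have central: "convolution G (sum_of (?C l)) a = convolution G a (sum_of (?C l))" for l a
  proof
    fix x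
    let ?S = "{(u, v). u \<in> B \<and> v \<in> B \<and> u \<circ> v = x}"
    show "convolution G (sum_of (?C l)) a x = convolution G a (sum_of (?C l)) x"
      unfolding convolution_def G
    proof (rule sum.reindex_bij_witness[where
          i = "\<lambda>(v, w). (v \<circ> w \<circ> inv_into UNIV v, v)" and
          j = "\<lambda>(u, v). (v, inv_into UNIV v \<circ> u \<circ> v)"])
      fix p assume "p \<in> ?S"
      then obtain u v where p: "p = (u, v)" "u \<in> B" "v \<in> B" "u \<circ> v = x" by auto
      have e: "v \<circ> (inv_into UNIV v \<circ> u \<circ> v) \<circ> inv_into UNIV v = u"
        by (simp only: o_assoc inv[OF p(3)] id_o) (simp only: o_assoc[symmetric] inv[OF p(3)] o_id)
      show "(case case p of (u, v) \<Rightarrow> (v, inv_into UNIV v \<circ> u \<circ> v) of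
          (v, w) \<Rightarrow> (v \<circ> w \<circ> inv_into UNIV v, v)) = p"
        using e p(1) by simp
      show "(case p of (u, v) \<Rightarrow> (v, inv_into UNIV v \<circ> u \<circ> v)) \<in> ?S"
        using p comp conj by (simp add: o_assoc inv)
      have "inv_into UNIV v \<circ> u \<circ> v \<in> ?C l \<longleftrightarrow> u \<in> ?C l"
      proof
        assume "inv_into UNIV v \<circ> u \<circ> v \<in> ?C l"
        from conj_class_conj[OF this p(3)] show "u \<in> ?C l" unfolding e .
      next
        assume "u \<in> ?C l"
        from conj_class_conj[OF this conj[OF p(3)]] show "inv_into UNIV v \<circ> u \<circ> v \<in> ?C l"
          unfolding invinv[OF p(3)] .
      qed
      then show "(case case p of (u, v) \<Rightarrow> (v, inv_into UNIV v \<circ> u \<circ> v) of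
          (u, v) \<Rightarrow> a u * sum_of (?C l) v) = (case p of (u, v) \<Rightarrow> sum_of (?C l) u * a v)"
        using p(1) by (simp add: sum_of_def)
    next
      fix q assume "q \<in> ?S"
      then obtain v w where q: "q = (v, w)" "v \<in> B" "w \<in> B" "v \<circ> w = x" by auto
      have e: "inv_into UNIV v \<circ> (v \<circ> w \<circ> inv_into UNIV v) \<circ> v = w"
        by (simp only: o_assoc inv[OF q(2)] id_o) (simp only: o_assoc[symmetric] inv[OF q(2)] o_id)
      show "(case case q of (v, w) \<Rightarrow> (v \<circ> w \<circ> inv_into UNIV v, v) of
          (u, v) \<Rightarrow> (v, inv_into UNIV v \<circ> u \<circ> v)) = q"
        using e q(1) by simp
      have "v \<circ> w \<circ> inv_into UNIV v \<circ> v = x"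
        unfolding o_assoc[symmetric] inv[OF q(2)] o_id by (rule q(4))
      moreover have "x \<circ> inv_into UNIV v \<in> B"
        using comp[OF comp[OF q(2,3)] conj[OF q(2)]] unfolding q(4) .
      ultimately show "(case q of (v, w) \<Rightarrow> (v \<circ> w \<circ> inv_into UNIV v, v)) \<in> ?S"
        using q by simp
    qed
  qed
  have conv_add: "convolution G (\<lambda>x. f x + g x) a = (\<lambda>x. convolution G f a x + convolution G g a x)"
      "convolution G a (\<lambda>x. f x + g x) = (\<lambda>x. convolution G a f x + convolution G a g x)"
    for f g a
    by (simp_all add: convolution_def sum.distrib[symmetric] distrib_left distrib_right case_prod_unfold)
  have conv_smult: "convolution G (\<lambda>x. c * f x) a = (\<lambda>x. c * convolution G f a x)"
      "convolution G a (\<lambda>x. c * f x) = (\<lambda>x. c * convolution G a f x)"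
    for c f a
    by (simp_all add: convolution_def sum_distrib_left case_prod_unfold mult_ac)
  have inB: "finite S \<longleftrightarrow> True" if "S \<subseteq> B" for S :: "(nat \<Rightarrow> nat) set"
    using that finite_B finite_subset by blast
  have welldef: "card (?F x) = card (?F y)" if xy: "x \<in> ?C l" "y \<in> ?C l" for l x y
  proof -
    \<comment> \<open>Conjugation by \<pi> injects the factorizations of \<open>x\<close> into those
      of \<open>y\<close>; exchanging the roles of \<open>x\<close> and \<open>y\<close> then gives
      equality.\<close>
    have le: "card (?F x) \<le> card (?F y)" if xy': "x \<in> ?C l" "y \<in> ?C l" for x y
    proof -
      have "x \<in> B_perms k (\<Union>P0)" "y \<in> B_perms k (\<Union>P0)" "block_type P0 x = block_type P0 y"
        using xy' unfolding conj_class_eq B_eq by auto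
      from B_perms_conj_exists[OF k P0(1,2) this(1) P0(1,2) this(2,3)]
      obtain \<pi> where \<pi>: "\<pi> \<in> B_perms k (\<Union>(P0 \<union> P0))" "y = \<pi> \<circ> x \<circ> inv_into UNIV \<pi>"
        by blast
      then have \<pi>B: "\<pi> \<in> B" by (simp add: B_eq)
      let ?c = "\<lambda>u. \<pi> \<circ> u \<circ> inv_into UNIV \<pi>"
      have inj: "inj ?c"
      proof (rule inj_on_inverseI[where g = "\<lambda>u. inv_into UNIV \<pi> \<circ> u \<circ> \<pi>"])
        fix u :: "nat \<Rightarrow> nat"
        show "inv_into UNIV \<pi> \<circ> (\<pi> \<circ> u \<circ> inv_into UNIV \<pi>) \<circ> \<pi> = u"
          by (simp only: o_assoc inv[OF \<pi>B] id_o) (simp only: o_assoc[symmetric] inv[OF \<pi>B] o_id)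
      qed
      have hom: "?c u \<circ> ?c v = ?c (u \<circ> v)" for u v :: "nat \<Rightarrow> nat"
      proof -
        have "?c u \<circ> ?c v = \<pi> \<circ> u \<circ> (inv_into UNIV \<pi> \<circ> \<pi>) \<circ> v \<circ> inv_into UNIV \<pi>"
          by (simp only: o_assoc)
        then show ?thesis by (simp add: inv[OF \<pi>B] o_assoc)
      qed
      show ?thesis
      proof (rule card_inj_on_le[of "map_prod ?c ?c"])
        show "inj_on (map_prod ?c ?c) (?F x)"
          by (rule inj_on_subset[OF prod.inj_map[OF inj inj]]) simp
        show "map_prod ?c ?c ` ?F x \<subseteq> ?F y"
          using conj_class_conj[OF _ \<pi>B] \<pi>(2) by (auto simp: factorizations_def G hom)
        show "finite (?F y)"
          by (rule finite_subset[OF _ finite_B_factorizations[of y]])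
             (auto simp: factorizations_def G conj_class_eq)
      qed
    qed
    show ?thesis using le xy by (intro le_antisym)
  qed
  \<comment> \<open>The chosen representative only turns the count into a function of the class; by
    \<open>welldef\<close> every element of the class gives the same value.\<close>
  let ?N = "\<lambda>l. of_nat (card (?F (SOME x. x \<in> ?C l))) :: complex"
  have "center_coeff k n \<Lambda> \<Delta> \<Gamma> = ?N \<Gamma>"
    unfolding center_coeff_def center_algebra_def G_def[symmetric]
  proof (rule structure_coeff_eq)
    show "add ?A = (\<lambda>f g x. f x + g x)" "zero ?A = (\<lambda>_. 0)" "smult ?A = (\<lambda>a f x. a * f x)"
      by (simp_all add: center_of_def group_algebra_def formal_algebra_def)
    show "(\<lambda>x. f x + g x) \<in> carrier ?A" if "f \<in> carrier ?A" "g \<in> carrier ?A" for f g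
    proof -
      have "{x. f x + g x \<noteq> 0} \<subseteq> {x. f x \<noteq> 0} \<union> {x. g x \<noteq> 0}" by auto
      then have "{x. f x + g x \<noteq> 0} \<subseteq> B" using that by (auto simp: car)
      then show ?thesis using that by (simp add: car conv_add inB)
    qed
    show "(\<lambda>_. 0) \<in> carrier ?A" by (simp add: car convolution_def case_prod_unfold)
    show "(\<lambda>x. c * f x) \<in> carrier ?A" if "f \<in> carrier ?A" for c f
    proof -
      have "{x. c * f x \<noteq> 0} \<subseteq> B" using that by (auto simp: car)
      then show ?thesis using that by (simp add: car conv_smult inB del: mult_eq_0_iff)
    qed
    show "sum_of (?C l) \<in> carrier ?A" for l
    proof -
      have "{x. sum_of (?C l) x \<noteq> 0} \<subseteq> B" by (auto simp: sum_of_def conj_class_eq)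
      then show ?thesis using central by (simp add: car inB)
    qed
    show "?C l \<noteq> {}" if "l \<in> {\<Lambda> \<in> families k. fam_size k \<Lambda> = n}" for l
      using exists_B_perm[OF k P0(1,2), of l] that P0(4) by (auto simp: conj_class_eq B_eq)
    show "l = l'" if "x \<in> ?C l" "x \<in> ?C l'" for l l' x
      using that by (simp add: conj_class_eq)
    show "(sum_of (?C \<Lambda>) \<otimes>\<^bsub>?A\<^esub> sum_of (?C \<Delta>)) x = ?N l" if "x \<in> ?C l" for l x
      unfolding prod using welldef[OF that someI[of "\<lambda>x. x \<in> ?C l", OF that]] by simp
    show "(sum_of (?C \<Lambda>) \<otimes>\<^bsub>?A\<^esub> sum_of (?C \<Delta>)) x = 0"
      if x: "\<And>l. l \<in> {\<Lambda> \<in> families k. fam_size k \<Lambda> = n} \<Longrightarrow> x \<notin> ?C l" for x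
    proof -
      have "x \<notin> B"
      proof
        assume xB: "x \<in> B"
        then have "x \<in> B_perms k (\<Union>P0)" by (simp only: B_eq)
        from block_type_families[OF k P0(1,2) this] P0(4)
        have "block_type P0 x \<in> {\<Lambda> \<in> families k. fam_size k \<Lambda> = n}" by simp
        from x[OF this] show False using xB by (simp add: conj_class_eq)
      qed
      then have "?F x = {}" using comp by (auto simp: factorizations_def G conj_class_eq)
      then show ?thesis unfolding prod by simp
    qed
    show "finite {l \<in> {\<Lambda> \<in> families k. fam_size k \<Lambda> = n}. ?N l \<noteq> 0}"
      by (rule finite_subset[OF _ finite_families_of_size[OF k, of n]]) auto
    show "\<Gamma> \<in> {\<Lambda> \<in> families k. fam_size k \<Lambda> = n}" using \<Gamma> by simp
  qed
  then show ?thesis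
    using welldef[OF someI[of "\<lambda>x. x \<in> ?C \<Gamma>", OF \<omega>] \<omega>] unfolding G_def by simp
qed

end

section \<open>Class sums in the algebra of partial permutations\<close>

lemma partial_class_nonempty:
  assumes k: "1 \<le> k" and \<Lambda>: "\<Lambda> \<in> families k"
  shows "partial_class k \<Lambda> \<noteq> {}"
proof -
  let ?P = "tuple k ` {1..fam_size k \<Lambda>}"
  have P: "finite ?P" "?P \<subseteq> tuples k" by (auto simp: tuples_def)
  have "fam_size k \<Lambda> = card ?P" by (simp only: card_tuples_interval[OF k])
  from exists_B_perm[OF k P \<Lambda> this]
  obtain \<omega> where "\<omega> \<in> B_perms k (\<Union>?P)" "block_type ?P \<omega> = \<Lambda>" by blast
  then have "(\<Union>?P, \<omega>) \<in> partial_class k \<Lambda>" unfolding partial_class_iff[OF k] using P by blast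
  then show ?thesis by blast
qed

lemma partial_classE:
  assumes "1 \<le> k" "z \<in> partial_class k \<Lambda>"
  obtains P \<omega> where "finite P" "P \<subseteq> tuples k" "\<omega> \<in> B_perms k (\<Union>P)" "block_type P \<omega> = \<Lambda>"
    "z = (\<Union>P, \<omega>)"
proof -
  obtain d \<omega> where z: "z = (d, \<omega>)" by (cases z)
  obtain P where "finite P" "P \<subseteq> tuples k" "d = \<Union>P" "\<omega> \<in> B_perms k (\<Union>P)" "block_type P \<omega> = \<Lambda>"
    using assms(2) unfolding z partial_class_iff[OF assms(1)] by blast
  then show thesis using that z by blast
qed

text \<open>The group argument carries over with a conjugator on the union of two domains in place
  of a group element. The finiteness of the support of the product needs its own argument, since the
  basis is infinite.\<close>

lemma partial_coeff_eq:
  assumes k: "1 \<le> k" and \<Gamma>: "\<Gamma> \<in> families k" and z: "z \<in> partial_class k \<Gamma>"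
  shows "partial_coeff k \<Lambda> \<Delta> \<Gamma> =
    of_nat (card (factorizations (partial_perms k) (partial_class k \<Lambda>) (partial_class k \<Delta>) z))"
proof -
  let ?M = "partial_perms k"
  let ?A = "partial_algebra k"
  let ?C = "partial_class k"
  let ?F = "factorizations ?M (?C \<Lambda>) (?C \<Delta>)"
  have sub: "?C l \<subseteq> carrier ?M" for l by (auto simp: partial_class_def)
  have finF: "finite {(a, b). a \<in> carrier ?M \<and> b \<in> carrier ?M \<and> a \<otimes>\<^bsub>?M\<^esub> b = x}" for x
    by (rule finite_factorizations)
  have prod: "(sum_of (?C \<Lambda>) \<otimes>\<^bsub>?A\<^esub> sum_of (?C \<Delta>)) x = of_nat (card (?F x))" for x
    unfolding partial_algebra_def formal_algebra_def monoid.select_convs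
    by (rule convolution_sum_of[OF sub sub finF])
  have finite_F: "finite (?F x)" for x
    by (rule finite_subset[OF _ finF[of x]]) (use sub in \<open>auto simp: factorizations_def\<close>)
  have mult: "(d1, \<omega>1) \<otimes>\<^bsub>?M\<^esub> (d2, \<omega>2) = (d1 \<union> d2, \<omega>1 \<circ> \<omega>2)" for d1 d2 \<omega>1 \<omega>2
    by (simp add: partial_perms_def)
  have F_dest: "\<exists>P1 P2 \<omega>1 \<omega>2. finite P1 \<and> P1 \<subseteq> tuples k \<and> finite P2 \<and> P2 \<subseteq> tuples k \<and>
      a = (\<Union>P1, \<omega>1) \<and> b = (\<Union>P2, \<omega>2) \<and> \<omega>1 \<in> B_perms k (\<Union>P1) \<and> \<omega>2 \<in> B_perms k (\<Union>P2) \<and>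
      block_type P1 \<omega>1 = \<Lambda> \<and> block_type P2 \<omega>2 = \<Delta> \<and> x = (\<Union>(P1 \<union> P2), \<omega>1 \<circ> \<omega>2)"
    if "(a, b) \<in> ?F x" for a b x
  proof -
    have ab: "a \<in> ?C \<Lambda>" "b \<in> ?C \<Delta>" "x = a \<otimes>\<^bsub>?M\<^esub> b"
      using that by (simp_all add: factorizations_def)
    obtain P1 \<omega>1 where P1: "finite P1" "P1 \<subseteq> tuples k" "\<omega>1 \<in> B_perms k (\<Union>P1)"
        "block_type P1 \<omega>1 = \<Lambda>" "a = (\<Union>P1, \<omega>1)"
      by (rule partial_classE[OF k ab(1)])
    obtain P2 \<omega>2 where P2: "finite P2" "P2 \<subseteq> tuples k" "\<omega>2 \<in> B_perms k (\<Union>P2)"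
        "block_type P2 \<omega>2 = \<Delta>" "b = (\<Union>P2, \<omega>2)"
      by (rule partial_classE[OF k ab(2)])
    have "x = (\<Union>(P1 \<union> P2), \<omega>1 \<circ> \<omega>2)"
      unfolding ab(3) P1(5) P2(5) mult Union_Un_distrib ..
    with P1 P2 show ?thesis by blast
  qed
  have welldef: "card (?F x) = card (?F y)" if xy: "x \<in> ?C l" "y \<in> ?C l" for l x y
  proof -
    have le: "card (?F x) \<le> card (?F y)" if xy': "x \<in> ?C l" "y \<in> ?C l" for x y
    proof -
      obtain P \<omega> where P: "finite P" "P \<subseteq> tuples k" "\<omega> \<in> B_perms k (\<Union>P)" "block_type P \<omega> = l"
          "x = (\<Union>P, \<omega>)"
        by (rule partial_classE[OF k xy'(1)])
      obtain P' \<omega>' where P': "finite P'" "P' \<subseteq> tuples k" "\<omega>' \<in> B_perms k (\<Union>P')" "block_type P' \<omega>' = l"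
          "y = (\<Union>P', \<omega>')"
        by (rule partial_classE[OF k xy'(2)])
      let ?Q = "P \<union> P'"
      have Q: "finite ?Q" "?Q \<subseteq> tuples k" using P P' by auto
      have "block_type P \<omega> = block_type P' \<omega>'" using P(4) P'(4) by simp
      from B_perms_conj_exists[OF k P(1-3) P'(1-3) this]
      obtain \<pi> where \<pi>: "\<pi> \<in> B_perms k (\<Union>?Q)" "(`) \<pi> ` P = P'" "\<omega>' = \<pi> \<circ> \<omega> \<circ> inv_into UNIV \<pi>"
        by blast
      have perm: "\<pi> permutes \<Union>?Q" using \<pi>(1) by (simp add: B_perms_def)
      have inv: "\<pi> \<circ> inv_into UNIV \<pi> = id" "inv_into UNIV \<pi> \<circ> \<pi> = id"
        using permutes_inv_o[OF perm] by auto
      let ?c = "\<lambda>u. \<pi> \<circ> u \<circ> inv_into UNIV \<pi>"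
      \<comment> \<open>Conjugating a partial permutation also moves its domain along \<pi>.\<close>
      let ?f = "map_prod ((`) \<pi>) ?c"
      have injc: "inj ?c"
      proof (rule inj_on_inverseI[where g = "\<lambda>u. inv_into UNIV \<pi> \<circ> u \<circ> \<pi>"])
        fix u :: "nat \<Rightarrow> nat"
        show "inv_into UNIV \<pi> \<circ> (\<pi> \<circ> u \<circ> inv_into UNIV \<pi>) \<circ> \<pi> = u"
          by (simp only: o_assoc inv id_o) (simp only: o_assoc[symmetric] inv o_id)
      qed
      have inji: "inj ((`) \<pi>)" using permutes_inj[OF perm] by (simp add: inj_image_eq_iff inj_def)
      have injf: "inj ?f" using prod.inj_map[OF inji injc] .
      have hom: "?c u \<circ> ?c v = ?c (u \<circ> v)" for u v :: "nat \<Rightarrow> nat"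
      proof -
        have "?c u \<circ> ?c v = \<pi> \<circ> u \<circ> (inv_into UNIV \<pi> \<circ> \<pi>) \<circ> v \<circ> inv_into UNIV \<pi>"
          by (simp only: o_assoc)
        then show ?thesis by (simp add: inv o_assoc)
      qed
      have C_conj: "?f (\<Union>R, \<sigma>) \<in> ?C m"
        if R: "R \<subseteq> ?Q" "\<sigma> \<in> B_perms k (\<Union>R)" "block_type R \<sigma> = m" for R \<sigma> m
      proof -
        note c = B_perms_conj[OF k Q \<pi>(1) R(1,2)]
        have "finite ((`) \<pi> ` R)" "(`) \<pi> ` R \<subseteq> tuples k" using c(1) Q finite_subset by auto
        then show ?thesis using c R(3) by (auto simp: partial_class_iff[OF k])
      qed
      show ?thesis
      proof (rule card_inj_on_le[of "map_prod ?f ?f"])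
        show "inj_on (map_prod ?f ?f) (?F x)"
          by (rule inj_on_subset[OF prod.inj_map[OF injf injf]]) simp
        show "finite (?F y)" by (rule finite_F)
        show "map_prod ?f ?f ` ?F x \<subseteq> ?F y"
        proof (rule image_subsetI)
          fix p assume p: "p \<in> ?F x"
          obtain a b where ab: "p = (a, b)" by (cases p)
          from F_dest[OF p[unfolded ab]]
          obtain P1 P2 \<omega>1 \<omega>2 where f: "finite P1" "P1 \<subseteq> tuples k" "finite P2" "P2 \<subseteq> tuples k"
            "a = (\<Union>P1, \<omega>1)" "b = (\<Union>P2, \<omega>2)" "\<omega>1 \<in> B_perms k (\<Union>P1)" "\<omega>2 \<in> B_perms k (\<Union>P2)"
            "block_type P1 \<omega>1 = \<Lambda>" "block_type P2 \<omega>2 = \<Delta>" "x = (\<Union>(P1 \<union> P2), \<omega>1 \<circ> \<omega>2)"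
            by blast
          have U: "\<Union>(P1 \<union> P2) = \<Union>P" and w: "\<omega>1 \<circ> \<omega>2 = \<omega>" using f(11) P(5) by auto
          \<comment> \<open>The domains of the factors lie inside the domain of the product, hence
            among the tuples permuted by \<pi>.\<close>
          have "P1 \<union> P2 = P"
            using Union_tuples_inject[OF k _ P(2) U] f(2,4) by simp
          then have sub: "P1 \<subseteq> ?Q" "P2 \<subseteq> ?Q" by auto
          have "?f a \<in> ?C \<Lambda>" unfolding f(5) by (rule C_conj[OF sub(1) f(7) f(9)])
          moreover have "?f b \<in> ?C \<Delta>" unfolding f(6) by (rule C_conj[OF sub(2) f(8) f(10)])
          moreover have "?f a \<otimes>\<^bsub>?M\<^esub> ?f b = y"
          proof -
            have "\<pi> ` \<Union>P1 \<union> \<pi> ` \<Union>P2 = \<pi> ` \<Union>P" unfolding U[symmetric] by blast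
            also have "\<dots> = \<Union>P'" unfolding \<pi>(2)[symmetric] by blast
            finally show ?thesis unfolding f(5,6) map_prod_simp mult hom w P'(5) \<pi>(3)[symmetric] by simp
          qed
          ultimately show "map_prod ?f ?f p \<in> ?F y" by (simp add: factorizations_def ab)
        qed
      qed
    qed
    show ?thesis using le xy by (intro le_antisym)
  qed
  let ?N = "\<lambda>l. of_nat (card (?F (SOME x. x \<in> ?C l))) :: complex"
  have car: "carrier ?A = {\<lambda>x. \<Sum>\<Lambda>\<in>F. a \<Lambda> * sum_of (?C \<Lambda>) x | F a. finite F \<and> F \<subseteq> families k}"
    by (simp add: partial_algebra_def formal_algebra_def)
  have carI: "f \<in> carrier ?A"
    if "f = (\<lambda>x. \<Sum>l\<in>F. a l * sum_of (?C l) x)" "finite F" "F \<subseteq> families k" for f F a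
    unfolding car by (rule CollectI, rule exI[of _ F], rule exI[of _ a]) (simp add: that)
  have "partial_coeff k \<Lambda> \<Delta> \<Gamma> = ?N \<Gamma>"
    unfolding partial_coeff_def
  proof (rule structure_coeff_eq)
    show "add ?A = (\<lambda>f g x. f x + g x)" "zero ?A = (\<lambda>_. 0)" "smult ?A = (\<lambda>a f x. a * f x)"
      by (simp_all add: partial_algebra_def formal_algebra_def)
    show "(\<lambda>x. f x + g x) \<in> carrier ?A" if fg: "f \<in> carrier ?A" "g \<in> carrier ?A" for f g
    proof -
      obtain F a G b where F: "finite F" "F \<subseteq> families k" "f = (\<lambda>x. \<Sum>\<Lambda>\<in>F. a \<Lambda> * sum_of (?C \<Lambda>) x)"
        and G: "finite G" "G \<subseteq> families k" "g = (\<lambda>x. \<Sum>\<Lambda>\<in>G. b \<Lambda> * sum_of (?C \<Lambda>) x)"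
        using fg unfolding car by blast
      \<comment> \<open>Coefficients are extended by 0 to the common index set before they are
        added.\<close>
      let ?a = "\<lambda>l. (if l \<in> F then a l else 0) + (if l \<in> G then b l else 0)"
      have "f x + g x = (\<Sum>l\<in>F \<union> G. ?a l * sum_of (?C l) x)" for x
      proof -
        have "f x = (\<Sum>l\<in>F \<union> G. (if l \<in> F then a l else 0) * sum_of (?C l) x)"
          unfolding F(3) by (rule sum.mono_neutral_cong_left) (use F(1,2) G(1,2) in auto)
        moreover have "g x = (\<Sum>l\<in>F \<union> G. (if l \<in> G then b l else 0) * sum_of (?C l) x)"
          unfolding G(3) by (rule sum.mono_neutral_cong_left) (use F(1,2) G(1,2) in auto)
        ultimately show ?thesis by (simp only: sum.distrib[symmetric] distrib_right)
      qed
      then have "(\<lambda>x. f x + g x) = (\<lambda>x. \<Sum>l\<in>F \<union> G. ?a l * sum_of (?C l) x)" by (rule ext)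
      moreover have "finite (F \<union> G)" "F \<union> G \<subseteq> families k" using F(1,2) G(1,2) by auto
      ultimately show ?thesis by (rule carI)
    qed
    show "(\<lambda>_. 0) \<in> carrier ?A"
      by (rule carI[of _ _ "{}"]) simp_all
    show "(\<lambda>x. c * f x) \<in> carrier ?A" if f: "f \<in> carrier ?A" for c f
    proof -
      obtain F a where F: "finite F" "F \<subseteq> families k" "f = (\<lambda>x. \<Sum>\<Lambda>\<in>F. a \<Lambda> * sum_of (?C \<Lambda>) x)"
        using f unfolding car by blast
      have "(\<lambda>x. c * f x) = (\<lambda>x. \<Sum>l\<in>F. (c * a l) * sum_of (?C l) x)"
        unfolding F(3) by (simp add: sum_distrib_left mult.assoc)
      then show ?thesis using F(1,2) by (rule carI)
    qed
    show "sum_of (?C l) \<in> carrier ?A" if "l \<in> families k" for l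
    proof -
      have "sum_of (?C l) = (\<lambda>x. \<Sum>\<Lambda>\<in>{l}. 1 * sum_of (?C \<Lambda>) x)" by simp
      then show ?thesis by (rule carI) (use that in auto)
    qed
    show "?C l \<noteq> {}" if "l \<in> families k" for l using partial_class_nonempty[OF k that] .
    show "l = l'" if "x \<in> ?C l" "x \<in> ?C l'" for l l' x
      using that by (auto simp: partial_class_def)
    show "(sum_of (?C \<Lambda>) \<otimes>\<^bsub>?A\<^esub> sum_of (?C \<Delta>)) x = ?N l" if "x \<in> ?C l" for l x
      unfolding prod using welldef[OF that someI[of "\<lambda>x. x \<in> ?C l", OF that]] by simp
    show "(sum_of (?C \<Lambda>) \<otimes>\<^bsub>?A\<^esub> sum_of (?C \<Delta>)) x = 0"
      if x: "\<And>l. l \<in> families k \<Longrightarrow> x \<notin> ?C l" for x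
    proof -
      have "?F x = {}"
      proof (rule equals0I)
        fix p assume p: "p \<in> ?F x"
        obtain a b where ab: "p = (a, b)" by (cases p)
        from F_dest[OF p[unfolded ab]]
        obtain P1 P2 \<omega>1 \<omega>2 where f: "finite P1" "P1 \<subseteq> tuples k" "finite P2" "P2 \<subseteq> tuples k"
          "\<omega>1 \<in> B_perms k (\<Union>P1)" "\<omega>2 \<in> B_perms k (\<Union>P2)" "x = (\<Union>(P1 \<union> P2), \<omega>1 \<circ> \<omega>2)"
          by blast
        have P: "finite (P1 \<union> P2)" "P1 \<union> P2 \<subseteq> tuples k" using f by auto
        have \<omega>: "\<omega>1 \<circ> \<omega>2 \<in> B_perms k (\<Union>(P1 \<union> P2))"
          using B_perms_mono(1)[OF k P _ f(5)] B_perms_mono(1)[OF k P _ f(6)] by (intro B_perms_comp) auto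
        then have "x \<in> ?C (block_type (P1 \<union> P2) (\<omega>1 \<circ> \<omega>2))"
          unfolding f(7) partial_class_iff[OF k] using P by blast
        then show False using x block_type_families(1)[OF k P \<omega>] by blast
      qed
      then show ?thesis unfolding prod by simp
    qed
    \<comment> \<open>If a type has a nonzero count, the domains of two factors cover a domain of
      that type; its size is thus at most the sum of the sizes of \<Lambda> and \<Delta>, and each
      size admits finitely many families.\<close>
    show "finite {l \<in> families k. ?N l \<noteq> 0}"
    proof (rule finite_subset)
      show "{l \<in> families k. ?N l \<noteq> 0} \<subseteq>
          (\<Union>n\<in>{..fam_size k \<Lambda> + fam_size k \<Delta>}. {l \<in> families k. fam_size k l = n})"
      proof
        fix l assume l: "l \<in> {l \<in> families k. ?N l \<noteq> 0}"
        define x where "x = (SOME x. x \<in> ?C l)"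
        have x: "x \<in> ?C l" unfolding x_def using partial_class_nonempty[OF k, of l] l by (simp add: some_in_eq)
        have "card (?F x) \<noteq> 0" using l by (simp add: x_def)
        then have "?F x \<noteq> {}" by (metis card.empty)
        then obtain a b where "(a, b) \<in> ?F x" by (metis ex_in_conv surj_pair)
        from F_dest[OF this]
        obtain P1 P2 \<omega>1 \<omega>2 where f: "finite P1" "P1 \<subseteq> tuples k" "finite P2" "P2 \<subseteq> tuples k"
          "\<omega>1 \<in> B_perms k (\<Union>P1)" "\<omega>2 \<in> B_perms k (\<Union>P2)" "block_type P1 \<omega>1 = \<Lambda>"
          "block_type P2 \<omega>2 = \<Delta>" "x = (\<Union>(P1 \<union> P2), \<omega>1 \<circ> \<omega>2)"
          by blast
        obtain P \<omega> where P: "finite P" "P \<subseteq> tuples k" "\<omega> \<in> B_perms k (\<Union>P)" "block_type P \<omega> = l"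
            "x = (\<Union>P, \<omega>)"
          by (rule partial_classE[OF k x])
        have U: "\<Union>(P1 \<union> P2) = \<Union>P" using f(9) P(5) by auto
        have "P1 \<union> P2 = P"
          using Union_tuples_inject[OF k _ P(2) U] f(2,4) by simp
        then have "card P \<le> card P1 + card P2" using card_Un_le by blast
        then have "fam_size k l \<le> fam_size k \<Lambda> + fam_size k \<Delta>"
          using block_type_families(2)[OF k f(1,2,5)] block_type_families(2)[OF k f(3,4,6)]
            block_type_families(2)[OF k P(1-3)] f(7,8) P(4) by simp
        then show "l \<in> (\<Union>n\<in>{..fam_size k \<Lambda> + fam_size k \<Delta>}. {l \<in> families k. fam_size k l = n})"
          using l by blast
      qed
      show "finite (\<Union>n\<in>{..fam_size k \<Lambda> + fam_size k \<Delta>}. {l \<in> families k. fam_size k l = n})"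
        using finite_families_of_size[OF k] by blast
    qed
    show "\<Gamma> \<in> families k" by (rule \<Gamma>)
  qed
  then show ?thesis using welldef[OF someI[of "\<lambda>x. x \<in> ?C \<Gamma>", OF z] z] by simp
qed

section \<open>Comparison of the two kinds of factorizations\<close>

text \<open>Both facts are read off a realization: a permutation of type \<Gamma>, regarded on m
  tuples, has the completed type.\<close>

lemma complete_to_families:
  assumes k: "1 \<le> k" and \<Gamma>: "\<Gamma> \<in> families k" and m: "fam_size k \<Gamma> \<le> m"
  shows "complete_to k m \<Gamma> \<in> families k" "fam_size k (complete_to k m \<Gamma>) = m"
proof -
  let ?P = "tuple k ` {1..fam_size k \<Gamma>}" and ?Q = "tuple k ` {1..m}"
  have P: "finite ?P" "?P \<subseteq> tuples k" and Q: "finite ?Q" "?Q \<subseteq> tuples k" by (auto simp: tuples_def)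
  have PQ: "?P \<subseteq> ?Q" using m by (intro image_mono) auto
  have "fam_size k \<Gamma> = card ?P" by (simp only: card_tuples_interval[OF k])
  from exists_B_perm[OF k P \<Gamma> this]
  obtain \<omega> where \<omega>: "\<omega> \<in> B_perms k (\<Union>?P)" "block_type ?P \<omega> = \<Gamma>" by blast
  have "block_type ?Q \<omega> = complete_to k m \<Gamma>"
    using block_type_extend[OF k Q PQ \<omega>(1)] unfolding \<omega>(2) card_tuples_interval[OF k] .
  then show "complete_to k m \<Gamma> \<in> families k" "fam_size k (complete_to k m \<Gamma>) = m"
    using block_type_families[OF k Q B_perms_mono(1)[OF k Q PQ \<omega>(1)]] unfolding card_tuples_interval[OF k]
    by auto
qed

lemma partial_class_proper:
  assumes "1 \<le> k" "proper k \<Lambda>" "(d, \<omega>) \<in> partial_class k \<Lambda>"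
  shows "d = \<Union>(moved_tuples k \<omega>)"
  using assms(2,3) moved_if_proper[OF assms(1)] unfolding partial_class_iff[OF assms(1)] by metis

text \<open>Forgetting the two domains is invertible, because properness recovers each of them from
  the moved tuples of its permutation. The summands are disjoint since \<open>P\<close> is
  determined by the domain of the product.\<close>

lemma card_center_factorizations:
  assumes k: "1 \<le> k" and proper: "proper k \<Lambda>" "proper k \<Delta>"
    and \<omega>: "\<omega> \<in> B_perms k {1..k * n}"
  shows "card (factorizations (B_group k {1..k * n})
      (conj_class k n (complete_to k n \<Lambda>)) (conj_class k n (complete_to k n \<Delta>)) \<omega>) =
    (\<Sum>P | moved_tuples k \<omega> \<subseteq> P \<and> P \<subseteq> tuple k ` {1..n}.
      card (factorizations (partial_perms k) (partial_class k \<Lambda>) (partial_class k \<Delta>) (\<Union>P, \<omega>)))"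
    (is "card ?A = (\<Sum>P\<in>?S. card (?F P))")
proof -
  let ?P0 = "tuple k ` {1..n}"
  have P0: "finite ?P0" "?P0 \<subseteq> tuples k" by (auto simp: tuples_def)
  have B: "B_perms k {1..k * n} = B_perms k (\<Union>?P0)" by (simp only: Union_tuples_interval)
  have mult: "(d1, \<omega>1) \<otimes>\<^bsub>partial_perms k\<^esub> (d2, \<omega>2) = (d1 \<union> d2, \<omega>1 \<circ> \<omega>2)" for d1 d2 \<omega>1 \<omega>2
    by (simp add: partial_perms_def)
  have finite_F: "finite (?F P)" for P
    by (rule finite_subset[OF _ finite_factorizations[of k "(\<Union>P, \<omega>)"]])
       (auto simp: factorizations_def partial_class_def)
  have tuples_subset: "P \<subseteq> Q" if "P \<subseteq> tuples k" "Q \<subseteq> tuples k" "\<Union>P \<subseteq> \<Union>Q" for P Q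
  proof -
    have "tuples_in k (\<Union>P) \<subseteq> tuples_in k (\<Union>Q)" using that(3) unfolding tuples_in_def by blast
    then show ?thesis by (simp only: tuples_in_Union[OF k] that(1,2))
  qed
  \<comment> \<open>The tuples outside \<open>d\<close> are fixed pointwise, so the type gains only
    parts 1 at \<open>ones k\<close>.\<close>
  have extend: "\<sigma> \<in> conj_class k n (complete_to k n L)"
    if z: "(d, \<sigma>) \<in> partial_class k L" and d: "d \<subseteq> \<Union>?P0" for d \<sigma> L
  proof -
    obtain P \<sigma>' where P: "finite P" "P \<subseteq> tuples k" "\<sigma>' \<in> B_perms k (\<Union>P)" "block_type P \<sigma>' = L"
        "(d, \<sigma>) = (\<Union>P, \<sigma>')"
      by (rule partial_classE[OF k z])
    have "P \<subseteq> ?P0" using tuples_subset[OF P(2) P0(2)] d P(5) by simp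
    then show ?thesis
      using block_type_extend[OF k P0 _ P(3)] B_perms_mono(1)[OF k P0 _ P(3)] P(4,5)
      unfolding conj_class_eq[OF k] B card_tuples_interval[OF k] by simp
  qed
  \<comment> \<open>As \<open>L\<close> is proper, the ones added by the completion can be told
    apart, and restriction to the moved tuples gives back \<open>L\<close>.\<close>
  have reduce: "(\<Union>(moved_tuples k \<sigma>), \<sigma>) \<in> partial_class k L \<and> moved_tuples k \<sigma> \<subseteq> ?P0 \<and>
      \<sigma> \<in> B_perms k (\<Union>(moved_tuples k \<sigma>))"
    if "\<sigma> \<in> conj_class k n (complete_to k n L)" "proper k L" for \<sigma> L
  proof -
    have \<sigma>: "\<sigma> \<in> B_perms k (\<Union>?P0)" "block_type ?P0 \<sigma> = complete_to k n L"
      using that(1) unfolding conj_class_eq[OF k] B by auto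
    have M: "moved_tuples k \<sigma> \<subseteq> ?P0" by (rule moved_tuples_subset[OF P0(2) \<sigma>(1)])
    then have "finite (moved_tuples k \<sigma>)" "moved_tuples k \<sigma> \<subseteq> tuples k"
      using P0 finite_subset by (blast, blast)
    then show ?thesis
      using M B_perms_moved[OF k P0 \<sigma>(1)] block_type_moved[OF k P0 \<sigma> that(2)]
      unfolding partial_class_iff[OF k] by blast
  qed
  have "bij_betw (map_prod snd snd) (\<Union>P\<in>?S. ?F P) ?A"
    unfolding bij_betw_def
  proof
    show "inj_on (map_prod snd snd) (\<Union>P\<in>?S. ?F P)"
    proof (rule inj_on_inverseI[where
          g = "\<lambda>(\<alpha>, \<beta>). ((\<Union>(moved_tuples k \<alpha>), \<alpha>), (\<Union>(moved_tuples k \<beta>), \<beta>))"])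
      fix p assume "p \<in> (\<Union>P\<in>?S. ?F P)"
      then obtain d1 \<alpha> d2 \<beta> where p: "p = ((d1, \<alpha>), (d2, \<beta>))"
          "(d1, \<alpha>) \<in> partial_class k \<Lambda>" "(d2, \<beta>) \<in> partial_class k \<Delta>"
        by (auto simp: factorizations_def)
      show "(case map_prod snd snd p of (\<alpha>, \<beta>) \<Rightarrow>
          ((\<Union>(moved_tuples k \<alpha>), \<alpha>), (\<Union>(moved_tuples k \<beta>), \<beta>))) = p"
        using partial_class_proper[OF k proper(1) p(2)] partial_class_proper[OF k proper(2) p(3)] p(1)
        by simp
    qed
    show "map_prod snd snd ` (\<Union>P\<in>?S. ?F P) = ?A"
    proof (intro equalityI subsetI)
      fix q assume "q \<in> map_prod snd snd ` (\<Union>P\<in>?S. ?F P)"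
      then obtain P d1 \<alpha> d2 \<beta> where q: "P \<in> ?S" "q = (\<alpha>, \<beta>)" "(d1, \<alpha>) \<in> partial_class k \<Lambda>"
          "(d2, \<beta>) \<in> partial_class k \<Delta>" "d1 \<union> d2 = \<Union>P" "\<alpha> \<circ> \<beta> = \<omega>"
        by (auto simp: factorizations_def mult)
      have "\<Union>P \<subseteq> \<Union>?P0" using q(1) by (intro Union_mono) simp
      then have sub: "d1 \<subseteq> \<Union>?P0" "d2 \<subseteq> \<Union>?P0" unfolding q(5)[symmetric] by simp_all
      note extend[OF q(3) sub(1)] extend[OF q(4) sub(2)]
      then show "q \<in> ?A" using q(2,6) by (simp add: factorizations_def B_group_def)
    next
      fix q assume "q \<in> ?A"
      then obtain \<alpha> \<beta> where q: "q = (\<alpha>, \<beta>)" "\<alpha> \<in> conj_class k n (complete_to k n \<Lambda>)"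
          "\<beta> \<in> conj_class k n (complete_to k n \<Delta>)" "\<alpha> \<circ> \<beta> = \<omega>"
        by (auto simp: factorizations_def B_group_def)
      let ?P1 = "moved_tuples k \<alpha>" and ?P2 = "moved_tuples k \<beta>"
      note r1 = reduce[OF q(2) proper(1)] and r2 = reduce[OF q(3) proper(2)]
      have P: "?P1 \<union> ?P2 \<subseteq> ?P0" using r1 r2 by blast
      then have P': "finite (?P1 \<union> ?P2)" "?P1 \<union> ?P2 \<subseteq> tuples k" using P0 finite_subset by (blast, blast)
      have "\<alpha> \<circ> \<beta> \<in> B_perms k (\<Union>(?P1 \<union> ?P2))"
        using B_perms_mono(1)[OF k P', of ?P1 \<alpha>] B_perms_mono(1)[OF k P', of ?P2 \<beta>] r1 r2
        by (intro B_perms_comp) auto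
      \<comment> \<open>The inclusion can be strict, since \<alpha> and \<beta> may undo each other
        on some tuples. These surplus tuples are what the summation index r of the theorem
        counts.\<close>
      then have "moved_tuples k \<omega> \<subseteq> ?P1 \<union> ?P2"
        unfolding q(4) by (rule moved_tuples_subset[OF P'(2)])
      then have "?P1 \<union> ?P2 \<in> ?S" using P by blast
      moreover have "((\<Union>?P1, \<alpha>), (\<Union>?P2, \<beta>)) \<in> ?F (?P1 \<union> ?P2)"
        using r1 r2 q(4) by (simp add: factorizations_def mult Union_Un_distrib)
      ultimately have "((\<Union>?P1, \<alpha>), (\<Union>?P2, \<beta>)) \<in> (\<Union>P\<in>?S. ?F P)" by blast
      from imageI[OF this, of "map_prod snd snd"]
      show "q \<in> map_prod snd snd ` (\<Union>P\<in>?S. ?F P)" by (simp add: q(1))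
    qed
  qed
  then have "card ?A = card (\<Union>P\<in>?S. ?F P)" by (rule bij_betw_same_card[symmetric])
  also have "\<dots> = (\<Sum>P\<in>?S. card (?F P))"
  proof (rule card_UN_disjoint)
    show "finite ?S" by (rule finite_subset[of _ "Pow ?P0"]) auto
    show "\<forall>P\<in>?S. finite (?F P)" using finite_F by blast
    show "\<forall>P\<in>?S. \<forall>Q\<in>?S. P \<noteq> Q \<longrightarrow> ?F P \<inter> ?F Q = {}"
    proof (intro ballI impI equals0I)
      fix P Q p assume PQ: "P \<in> ?S" "Q \<in> ?S" "P \<noteq> Q" "p \<in> ?F P \<inter> ?F Q"
      from PQ(4) obtain a b where "a \<otimes>\<^bsub>partial_perms k\<^esub> b = (\<Union>P, \<omega>)"
          "a \<otimes>\<^bsub>partial_perms k\<^esub> b = (\<Union>Q, \<omega>)"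
        unfolding factorizations_def by blast
      then have "\<Union>P = \<Union>Q" by simp
      moreover have "P \<subseteq> ?P0" "Q \<subseteq> ?P0" using PQ(1,2) by simp_all
      then have "P \<subseteq> tuples k" "Q \<subseteq> tuples k" by (simp_all only: subset_trans[OF _ P0(2)])
      ultimately have "P = Q" by (intro Union_tuples_inject[OF k])
      then show False using PQ(3) by blast
    qed
  qed
  finally show ?thesis .
qed

text \<open>A set between \<open>A\<close> and \<open>B\<close> is \<open>A\<close> together with a
  subset of \<open>B - A\<close>, and these subsets are grouped by their number r of
  elements.\<close>

lemma sum_supersets_card:
  fixes f :: "nat \<Rightarrow> 'a::comm_semiring_1"
  assumes "finite B" "A \<subseteq> B"
  shows "(\<Sum>P | A \<subseteq> P \<and> P \<subseteq> B. f (card P)) =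
    (\<Sum>r = 0..card B - card A. f (card A + r) * of_nat ((card B - card A) choose r))"
proof -
  let ?D = "B - A"
  have fin: "finite A" "finite ?D" using assms finite_subset by auto
  have card_D: "card ?D = card B - card A" using assms fin by (simp add: card_Diff_subset)
  have "(\<Sum>P | A \<subseteq> P \<and> P \<subseteq> B. f (card P)) = (\<Sum>R\<in>Pow ?D. f (card A + card R))"
  proof (rule sum.reindex_bij_witness[where i = "\<lambda>R. A \<union> R" and j = "\<lambda>P. P - A"])
    fix P assume P: "P \<in> {P. A \<subseteq> P \<and> P \<subseteq> B}"
    then have "finite P" using assms(1) finite_subset by blast
    then have "card (P - A) = card P - card A" "card A \<le> card P"
      using P fin by (auto simp: card_Diff_subset card_mono)
    then show "f (card A + card (P - A)) = f (card P)" by simp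
  qed (use assms in auto)
  also have "\<dots> = (\<Sum>r\<in>{0..card ?D}. \<Sum>R\<in>{R \<in> Pow ?D. card R = r}. f (card A + card R))"
    by (rule sum.group[symmetric]) (use fin card_mono[OF fin(2)] in auto)
  also have "\<dots> = (\<Sum>r = 0..card ?D. f (card A + r) * of_nat (card ?D choose r))"
  proof (rule sum.cong[OF refl])
    fix r
    have "(\<Sum>R\<in>{R \<in> Pow ?D. card R = r}. f (card A + card R)) =
        (\<Sum>R\<in>{R \<in> Pow ?D. card R = r}. f (card A + r))"
      by (rule sum.cong) auto
    also have "\<dots> = of_nat (card {R \<in> Pow ?D. card R = r}) * f (card A + r)" by simp
    also have "card {R \<in> Pow ?D. card R = r} = card ?D choose r"
      using n_subsets[OF fin(2), of r] by (simp add: Pow_def)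
    finally show "(\<Sum>R\<in>{R \<in> Pow ?D. card R = r}. f (card A + card R)) =
        f (card A + r) * of_nat (card ?D choose r)"
      by (simp add: mult.commute)
  qed
  finally show ?thesis unfolding card_D .
qed

theorem theorem4p1:
  fixes k :: nat and \<Lambda> \<Delta> \<Gamma> :: family
  assumes "k \<ge> 1"
    and "\<Lambda> \<in> families k" "\<Delta> \<in> families k" "\<Gamma> \<in> families k"
    and "proper k \<Lambda>" "proper k \<Delta>" "proper k \<Gamma>"
    and "max (fam_size k \<Lambda>) (fam_size k \<Delta>) \<le> fam_size k \<Gamma>"
    and "fam_size k \<Gamma> \<le> fam_size k \<Lambda> + fam_size k \<Delta>"
  shows "(\<forall>n \<ge> fam_size k \<Gamma>.
            center_coeff k n (complete_to k n \<Lambda>) (complete_to k n \<Delta>) (complete_to k n \<Gamma>)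
            = (\<Sum>r = 0..n - fam_size k \<Gamma>.
                 partial_coeff k \<Lambda> \<Delta> (complete_to k (fam_size k \<Gamma> + r) \<Gamma>)
                 * of_nat ((n - fam_size k \<Gamma>) choose r)))
         \<and> (\<forall>r. partial_coeff k \<Lambda> \<Delta> (complete_to k (fam_size k \<Gamma> + r) \<Gamma>) \<in> \<nat>)"
proof (intro conjI allI impI)
  note k = assms(1)
  fix n assume n: "fam_size k \<Gamma> \<le> n"
  let ?P0 = "tuple k ` {1..n}"
  let ?\<Lambda> = "complete_to k n \<Lambda>" and ?\<Delta> = "complete_to k n \<Delta>" and ?\<Gamma> = "complete_to k n \<Gamma>"
  have P0: "finite ?P0" "?P0 \<subseteq> tuples k" "card ?P0 = n"
    using card_tuples_interval[OF k] by (auto simp: tuples_def)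
  note \<Gamma>n = complete_to_families[OF k assms(4) n]
  \<comment> \<open>One representative suffices, as the coefficient is the number of factorizations
    of any element of the class.\<close>
  obtain \<omega> where \<omega>: "\<omega> \<in> B_perms k (\<Union>?P0)" "block_type ?P0 \<omega> = ?\<Gamma>"
    using exists_B_perm[OF k P0(1,2) \<Gamma>n(1)] \<Gamma>n(2) P0(3) by auto
  have B: "B_perms k (\<Union>?P0) = B_perms k {1..k * n}" by (simp only: Union_tuples_interval)
  have \<omega>C: "\<omega> \<in> conj_class k n ?\<Gamma>" using \<omega> unfolding conj_class_eq[OF k] B by blast
  let ?M = "moved_tuples k \<omega>"
  have M: "?M \<subseteq> ?P0" by (rule moved_tuples_subset[OF P0(2) \<omega>(1)])
  then have M': "finite ?M" "?M \<subseteq> tuples k" using P0 finite_subset by (blast, blast)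
  have \<omega>M: "\<omega> \<in> B_perms k (\<Union>?M)" by (rule B_perms_moved[OF k P0(1,2) \<omega>(1)])
  \<comment> \<open>Properness of \<Gamma> is used here: it makes the number of moved tuples exactly
    \<open>fam_size k \<Gamma>\<close>, the offset in the final sum.\<close>
  have typeM: "block_type ?M \<omega> = \<Gamma>" by (rule block_type_moved[OF k P0(1,2) \<omega> assms(7)])
  have cardM: "card ?M = fam_size k \<Gamma>" using block_type_families(2)[OF k M' \<omega>M] typeM by simp
  have "center_coeff k n ?\<Lambda> ?\<Delta> ?\<Gamma> =
      of_nat (\<Sum>P | ?M \<subseteq> P \<and> P \<subseteq> ?P0.
        card (factorizations (partial_perms k) (partial_class k \<Lambda>) (partial_class k \<Delta>) (\<Union>P, \<omega>)))"
    unfolding center_coeff_eq[OF k \<Gamma>n \<omega>C]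
      card_center_factorizations[OF k assms(5,6) \<omega>(1)[unfolded B]] ..
  also have "\<dots> = (\<Sum>P | ?M \<subseteq> P \<and> P \<subseteq> ?P0. partial_coeff k \<Lambda> \<Delta> (complete_to k (card P) \<Gamma>))"
    unfolding of_nat_sum
  proof (rule sum.cong[OF refl])
    fix P assume "P \<in> {P. ?M \<subseteq> P \<and> P \<subseteq> ?P0}"
    then have P: "?M \<subseteq> P" "P \<subseteq> ?P0" by auto
    then have P': "finite P" "P \<subseteq> tuples k" using P0 finite_subset by (blast, blast)
    \<comment> \<open>The set \<open>P\<close> contains the moved tuples, so it is large enough for
      \<Gamma> to be completed to its size.\<close>
    have "complete_to k (card P) \<Gamma> \<in> families k"
      using complete_to_families(1)[OF k assms(4)] cardM card_mono[OF P'(1) P(1)] by simp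
    moreover have "(\<Union>P, \<omega>) \<in> partial_class k (complete_to k (card P) \<Gamma>)"
      using block_type_extend[OF k P' P(1) \<omega>M] B_perms_mono(1)[OF k P' P(1) \<omega>M] P' typeM
      unfolding partial_class_iff[OF k] by auto
    ultimately show "of_nat (card (factorizations (partial_perms k) (partial_class k \<Lambda>)
        (partial_class k \<Delta>) (\<Union>P, \<omega>))) = partial_coeff k \<Lambda> \<Delta> (complete_to k (card P) \<Gamma>)"
      using partial_coeff_eq[OF k] by simp
  qed
  also have "\<dots> = (\<Sum>r = 0..n - fam_size k \<Gamma>.
      partial_coeff k \<Lambda> \<Delta> (complete_to k (fam_size k \<Gamma> + r) \<Gamma>) * of_nat ((n - fam_size k \<Gamma>) choose r))"
    using sum_supersets_card[OF P0(1) M, of "\<lambda>m. partial_coeff k \<Lambda> \<Delta> (complete_to k m \<Gamma>)"]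
    unfolding cardM P0(3) .
  finally show "center_coeff k n ?\<Lambda> ?\<Delta> ?\<Gamma> = \<dots>" .
next
  note k = assms(1)
  fix r
  have \<Gamma>: "complete_to k (fam_size k \<Gamma> + r) \<Gamma> \<in> families k"
    by (rule complete_to_families(1)[OF k assms(4)]) simp
  \<comment> \<open>Once the completed family is realized by some \<open>z\<close>, the coefficient
    is the cardinality of a set of factorizations of \<open>z\<close>, hence a natural
    number.\<close>
  obtain z where "z \<in> partial_class k (complete_to k (fam_size k \<Gamma> + r) \<Gamma>)"
    using partial_class_nonempty[OF k \<Gamma>] by blast
  then show "partial_coeff k \<Lambda> \<Delta> (complete_to k (fam_size k \<Gamma> + r) \<Gamma>) \<in> \<nat>"
    using partial_coeff_eq[OF k \<Gamma>] by simp
qed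

end
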